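(* Let $A$ be a finite involutively closed alphabet and let $\Gamma^{(1)},\ldots,\Gamma^{(k)}$ be complete context-free $A$-graphs such that the group $\mathcal{G}(\Gamma^{(1)}\sqcup\cdots\sqcup\Gamma^{(k)})$ is infinite. Then $\mathcal{G}(\Gamma^{(1)}\sqcup\cdots\sqcup\Gamma^{(k)})$ does not contain an infinite finitely generated torsion subgroup.
   Context: Let $A$ be a finite alphabet closed under a formal inversion $a\mapsto a^{-1}$ ($a^{-1}\ne a$, $(a^{-1})^{-1}=a$), $A^*$ the free monoid on $A$, and $F_A$ the free group whose elements are the reduced words over $A$. An $A$-graph is a connected directed graph $\Gamma$ with vertex set $V(\Gamma)$, edges labeled by letters of $A$, and a fixed-point-free involution $e\mapsto e^{-1}$ on edges which exchanges initial and terminal vertices and inverts labels, and which is deterministic: for each vertex $v$ and each $a\in A$ there is at most one edge labeled $a$ starting at $v$. It is complete if for each $v$ and $a$ there is at least one such edge. A circuit is a walk whose initial and terminal vertices coincide. $L(\Gamma,x)\subseteq A^*$ is the set of labels of circuits at the vertex $x$. $\Gamma$ is context-free if $L(\Gamma,x_0)$ is a context-free language for some (equivalently, every) vertex $x_0$. For complete $A$-graphs $\Gamma^{(1)},\ldots,\Gamma^{(k)}$ the transition group $\mathcal{G}(\Gamma^{(1)}\sqcup\cdots\sqcup\Gamma^{(k)})$ is the quotient of $F_A$ by the normal subgroup defined by $\bigcap_{i}\bigcap_{p\in V(\Gamma^{(i)})}L(\Gamma^{(i)},p)$; equivalently, it is the group of permutations of the disjoint union of the sets $V(\Gamma^{(i)})$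 generated by the permutations induced by the letters of $A$. *)

theory Defs
  imports
    "Graph_Theory.Digraph_Component"
    "Graph_Theory.Arc_Walk"
    "Graph_Theory.Bidirected_Digraph"
    "HOL-Algebra.Coset"
    "HOL-Algebra.Generated_Groups"
begin

section \<open>Context-free languages\<close>

datatype ('n, 't) symbol = Nonterm 'n | Term 't

type_synonym ('n, 't) production = "'n \<times> ('n, 't) symbol list"

inductive derives_step ::
  "('n, 't) production set \<Rightarrow> ('n, 't) symbol list \<Rightarrow> ('n, 't) symbol list \<Rightarrow> bool"
  for P where
  "(X, \<alpha>) \<in> P \<Longrightarrow> derives_step P (u @ [Nonterm X] @ v) (u @ \<alpha> @ v)"

definition grammar_language :: "('n, 't) production set \<Rightarrow> 'n \<Rightarrow> 't list set" where
  "grammar_language P S = {w. (derives_step P)\<^sup>*\<^sup>* [Nonterm S] (map Term w)}"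

text \<open>
  A grammar has finitely many productions, hence uses only finitely many nonterminals,
  so there is no loss of generality in naming them by natural numbers.
\<close>
definition context_free_language :: "'t list set \<Rightarrow> bool" where
  "context_free_language L \<longleftrightarrow>
     (\<exists>(P :: (nat, 't) production set) S. finite P \<and> L = grammar_language P S)"


section \<open>Involutive alphabets and free groups\<close>

locale involutive_alphabet =
  fixes A :: "'a set" and ainv :: "'a \<Rightarrow> 'a"
  assumes finite_alphabet: "finite A"
    and ainv_closed: "a \<in> A \<Longrightarrow> ainv a \<in> A"
    and ainv_neq: "a \<in> A \<Longrightarrow> ainv a \<noteq> a"
    and ainv_ainv: "a \<in> A \<Longrightarrow> ainv (ainv a) = a"

definition reduced :: "('a \<Rightarrow> 'a) \<Rightarrow> 'a list \<Rightarrow> bool" where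
  "reduced ainv w \<longleftrightarrow> successively (\<lambda>a b. b \<noteq> ainv a) w"

fun cancel_cons :: "('a \<Rightarrow> 'a) \<Rightarrow> 'a \<Rightarrow> 'a list \<Rightarrow> 'a list" where
  "cancel_cons ainv a [] = [a]"
| "cancel_cons ainv a (b # w) = (if b = ainv a then w else a # b # w)"

text \<open>The reduced word freely equivalent to a given word.\<close>
definition free_reduce :: "('a \<Rightarrow> 'a) \<Rightarrow> 'a list \<Rightarrow> 'a list" where
  "free_reduce ainv w = foldr (cancel_cons ainv) w []"

definition free_group :: "'a set \<Rightarrow> ('a \<Rightarrow> 'a) \<Rightarrow> 'a list monoid" where
  "free_group A ainv =
     \<lparr>carrier = {w \<in> lists A. reduced ainv w},
      mult = (\<lambda>u v. free_reduce ainv (u @ v)),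
      one = []\<rparr>"


section \<open>Labeled graphs\<close>

record ('v, 'e, 'a) labeled_graph =
  graph_of :: "('v, 'e) pre_digraph"
  edge_label :: "'e \<Rightarrow> 'a"
  edge_inv :: "'e \<Rightarrow> 'e"

text \<open>
  The locale \<^locale>\<open>bidirected_digraph\<close> provides the fixed-point-free involution on the edges;
  it totalizes the involution by the identity outside the edge set.
  Connectedness includes that there is at least one vertex.
\<close>
locale A_graph =
  involutive_alphabet A ainv + bidirected_digraph "graph_of \<Gamma>" "edge_inv \<Gamma>"
  for A :: "'a set" and ainv :: "'a \<Rightarrow> 'a" and \<Gamma> :: "('v, 'e, 'a) labeled_graph" +
  assumes graph_connected: "Digraph_Component.connected (graph_of \<Gamma>)"
    and label_in_alphabet: "e \<in> arcs (graph_of \<Gamma>) \<Longrightarrow> edge_label \<Gamma> e \<in> A"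
    and label_edge_inv:
      "e \<in> arcs (graph_of \<Gamma>) \<Longrightarrow> edge_label \<Gamma> (edge_inv \<Gamma> e) = ainv (edge_label \<Gamma> e)"
    and deterministic:
      "\<lbrakk>e \<in> arcs (graph_of \<Gamma>); f \<in> arcs (graph_of \<Gamma>);
        tail (graph_of \<Gamma>) e = tail (graph_of \<Gamma>) f; edge_label \<Gamma> e = edge_label \<Gamma> f\<rbrakk>
       \<Longrightarrow> e = f"

definition complete_graph :: "'a set \<Rightarrow> ('v, 'e, 'a) labeled_graph \<Rightarrow> bool" where
  "complete_graph A \<Gamma> \<longleftrightarrow>
     (\<forall>v \<in> verts (graph_of \<Gamma>). \<forall>a \<in> A.
        \<exists>e \<in> arcs (graph_of \<Gamma>). tail (graph_of \<Gamma>) e = v \<and> edge_label \<Gamma> e = a)"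

definition circuit_language :: "('v, 'e, 'a) labeled_graph \<Rightarrow> 'v \<Rightarrow> 'a list set" where
  "circuit_language \<Gamma> x =
     {map (edge_label \<Gamma>) p |p. pre_digraph.awalk (graph_of \<Gamma>) x p x}"

definition context_free_graph :: "('v, 'e, 'a) labeled_graph \<Rightarrow> bool" where
  "context_free_graph \<Gamma> \<longleftrightarrow>
     (\<exists>x \<in> verts (graph_of \<Gamma>). context_free_language (circuit_language \<Gamma> x))"


section \<open>Transition groups\<close>

text \<open>
  The image in the free group of the words that label a circuit at every vertex of every graph
  of the family. The vertices of the different graphs are quantified separately, so
  the vertex sets need not be disjoint as subsets of their common type.
\<close>
definition transition_kernel ::
  "'a set \<Rightarrow> ('a \<Rightarrow> 'a) \<Rightarrow> ('i \<Rightarrow> ('v, 'e, 'a) labeled_graph) \<Rightarrow> 'i set \<Rightarrow> 'a list set" where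
  "transition_kernel A ainv \<Gamma> I =
     free_reduce ainv `
       (lists A \<inter> (\<Inter>i \<in> I. \<Inter>p \<in> verts (graph_of (\<Gamma> i)). circuit_language (\<Gamma> i) p))"

definition transition_group ::
  "'a set \<Rightarrow> ('a \<Rightarrow> 'a) \<Rightarrow> ('i \<Rightarrow> ('v, 'e, 'a) labeled_graph) \<Rightarrow> 'i set \<Rightarrow> 'a list set monoid"
  where
  "transition_group A ainv \<Gamma> I = free_group A ainv Mod transition_kernel A ainv \<Gamma> I"


section \<open>Finitely generated and torsion subgroups\<close>

definition finitely_generated_in :: "('g, 'm) monoid_scheme \<Rightarrow> 'g set \<Rightarrow> bool" where
  "finitely_generated_in G H \<longleftrightarrow> (\<exists>S. finite S \<and> S \<subseteq> carrier G \<and> H = generate G S)"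

definition torsion_in :: "('g, 'm) monoid_scheme \<Rightarrow> 'g set \<Rightarrow> bool" where
  "torsion_in G H \<longleftrightarrow> (\<forall>h \<in> H. \<exists>n::nat. n > 0 \<and> h [^]\<^bsub>G\<^esub> n = \<one>\<^bsub>G\<^esub>)"

end

theory Submission
  imports Defs "HOL-Library.Sublist"
begin

text \<open>
A finitely generated torsion subgroup \<open>H\<close> of the transition group is finite. Represent its generators
by a finite set \<open>W\<close> of words, closed under inversion. The transition group acts faithfully on the disjoint
union of the vertex sets, and a monoid generated by finitely many maps is finite as soon as its orbits
have bounded size (\<open>finitely_many_actions_if_bounded_orbits\<close>). So it suffices to bound the \<open>W\<close>-orbits
on the vertices of a single complete context-free graph, given that all products of words from \<open>W\<close>
act with finite order.

Fix the root \<open>x0\<close> and call the distance of a vertex from \<open>x0\<close> its depth. In the theory of Muller and Schupp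
a context-free graph has only finitely many types of cones, where a cone is a component of the complement
of a ball around the root. If \<open>w\<close> leads from a vertex \<open>p\<close> along a path inside its cone to a vertex of
greater depth that corresponds to \<open>p\<close> in a cone of the same type, then every further reading of \<open>w\<close>
gains the same amount of depth, so \<open>w\<close> has infinite order. In a large orbit such a situation
occurs by the pigeonhole principle.

Instead of cones the proof works with local types of vertices, which come directly from a grammar
for the circuits at the root. If a sentential form occurs in the derivation of a circuit,
then all words that it generates join the same two vertices (\<open>connects\<close>), because they can be exchanged
for one another in the circuit. Consider a path \<open>c\<close> that starts and ends on level \<open>n\<close> and stays above it.
Completed by geodesics, it is a circuit at the root, and the place in its derivation where \<open>c\<close> is
first split shows that \<open>c\<close>, prolonged by boundedly many letters, is generated by a form that joins vertices
near the ends of \<open>c\<close> (\<open>crossing\<close>). The local type of \<open>p\<close> records which forms join points near \<open>p\<close>, and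
the relative depths of these points. There are finitely many types, and between vertices of the same
type one can transfer circuits (\<open>transfer_circuit\<close>) and relative depths (\<open>relative_depth_eq\<close>) of
paths that do not fall far below their origin. This gives the words of infinite order
(\<open>ascending_word_not_torsion\<close>) and the bound on orbits (\<open>torsion_orbits_bounded\<close>).

The remaining part identifies the elements of the transition group with the actions of words,
which requires that the reduced words form a group under concatenation followed by reduction.
\<close>

section \<open>Words generated by sentential forms\<close>

text \<open>
The words derived from a sentential form, by recursion on derivation trees instead of rewriting
steps: induction over this relation treats one symbol at a time and keeps track of which part of
the word that symbol produces.
\<close>

inductive generates ::
  "('n, 't) production set \<Rightarrow> ('n, 't) symbol list \<Rightarrow> 't list \<Rightarrow> bool"
  for P where
  Nil: "generates P [] []"
| Term: "generates P \<beta> w \<Longrightarrow> generates P (Term a # \<beta>) (a # w)"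
| Nonterm: "\<lbrakk>(X, \<alpha>) \<in> P; generates P \<alpha> u; generates P \<beta> w\<rbrakk>
    \<Longrightarrow> generates P (Nonterm X # \<beta>) (u @ w)"

inductive_cases generates_NilE: "generates P [] w"
inductive_cases generates_TermE: "generates P (Term a # \<beta>) w"
inductive_cases generates_NontermE: "generates P (Nonterm X # \<beta>) w"

lemma generates_append:
  "generates P \<alpha> u \<Longrightarrow> generates P \<beta> w \<Longrightarrow> generates P (\<alpha> @ \<beta>) (u @ w)"
  by (induction rule: generates.induct) (auto intro: generates.intros)

lemma generates_appendE:
  assumes "generates P (\<alpha> @ \<beta>) w"
  obtains u v where "w = u @ v" "generates P \<alpha> u" "generates P \<beta> v"
  using assms
proof (induction \<alpha> arbitrary: w thesis)
  case Nil
  then show ?case by (auto intro: generates.intros)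
next
  case (Cons s \<alpha>)
  show ?case
  proof (cases s)
    case (Nonterm X)
    with Cons.prems(2) obtain \<delta> w1 w2 where
      "(X, \<delta>) \<in> P" "generates P \<delta> w1" "generates P (\<alpha> @ \<beta>) w2" "w = w1 @ w2"
      by (auto elim: generates_NontermE)
    then show ?thesis using Cons Nonterm by (metis append.assoc generates.Nonterm)
  next
    case (Term a)
    with Cons.prems(2) obtain w2 where "generates P (\<alpha> @ \<beta>) w2" "w = a # w2"
      by (auto elim: generates_TermE)
    then show ?thesis using Cons Term by (metis append_Cons generates.Term)
  qed
qed

lemma generates_singleton: "(X, \<alpha>) \<in> P \<Longrightarrow> generates P \<alpha> w \<Longrightarrow> generates P [Nonterm X] w"
  using generates.Nonterm[OF _ _ generates.Nil] by force

lemma derives_imp_generates: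
  "(derives_step P)\<^sup>*\<^sup>* \<gamma> (map Term w) \<Longrightarrow> generates P \<gamma> w"
proof (induction rule: converse_rtranclp_induct)
  case base
  show ?case by (induction w) (auto intro: generates.intros)
next
  case (step \<gamma> \<delta>)
  from step.hyps(1) step.IH show ?case
  proof cases
    case (1 X \<alpha> u v)
    with step.IH obtain w1 w2 w3 where
      "w = w1 @ w2 @ w3" "generates P u w1" "generates P \<alpha> w2" "generates P v w3"
      by (metis generates_appendE)
    with 1 show ?thesis by (metis generates_append generates_singleton)
  qed
qed

lemma derives_context:
  "(derives_step P)\<^sup>*\<^sup>* \<gamma> \<delta> \<Longrightarrow> (derives_step P)\<^sup>*\<^sup>* (u @ \<gamma> @ v) (u @ \<delta> @ v)"
proof (induction rule: rtranclp_induct)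
  case (step \<delta> \<epsilon>)
  from step.hyps(2) have "derives_step P (u @ \<delta> @ v) (u @ \<epsilon> @ v)"
  proof cases
    case (1 X \<alpha> u' v')
    then show ?thesis using derives_step.intros[of X \<alpha> P "u @ u'" "v' @ v"] by simp
  qed
  with step.IH show ?case by simp
qed simp

lemma generates_imp_derives:
  "generates P \<gamma> w \<Longrightarrow> (derives_step P)\<^sup>*\<^sup>* \<gamma> (map Term w)"
proof (induction rule: generates.induct)
  case (Term \<beta> w a)
  then show ?case using derives_context[of P \<beta> "map Term w" "[Term a]" "[]"] by simp
next
  case (Nonterm X \<alpha> u \<beta> w)
  have "derives_step P (Nonterm X # \<beta>) (\<alpha> @ \<beta>)"
    using derives_step.intros[OF Nonterm.hyps(1), of "[]" \<beta>] by simp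
  moreover have "(derives_step P)\<^sup>*\<^sup>* (\<alpha> @ \<beta>) (map Term u @ \<beta>)"
    using derives_context[OF Nonterm.IH(1), of "[]" \<beta>] by simp
  moreover have "(derives_step P)\<^sup>*\<^sup>* (map Term u @ \<beta>) (map Term u @ map Term w)"
    using derives_context[OF Nonterm.IH(2), of "map Term u" "[]"] by simp
  ultimately show ?case by (metis (no_types, lifting) converse_rtranclp_into_rtranclp
        map_append rtranclp_trans)
qed simp

lemma grammar_language_generates: "grammar_language P S = {w. generates P [Nonterm S] w}"
  by (auto simp: grammar_language_def intro: derives_imp_generates generates_imp_derives)


section \<open>Inverse words\<close>

definition inv_word :: "('a \<Rightarrow> 'a) \<Rightarrow> 'a list \<Rightarrow> 'a list" where
  "inv_word ainv w = rev (map ainv w)"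

lemma length_inv_word [simp]: "length (inv_word ainv w) = length w"
  by (simp add: inv_word_def)

lemma inv_word_append [simp]: "inv_word ainv (u @ v) = inv_word ainv v @ inv_word ainv u"
  by (simp add: inv_word_def)

lemma inv_word_simps [simp]:
  "inv_word ainv [] = []" "inv_word ainv (a # w) = inv_word ainv w @ [ainv a]"
  by (simp_all add: inv_word_def)

context involutive_alphabet
begin

lemma inv_word_closed [simp, intro]: "w \<in> lists A \<Longrightarrow> inv_word ainv w \<in> lists A"
  by (auto simp: inv_word_def ainv_closed)

lemma inv_word_inv_word [simp]: "w \<in> lists A \<Longrightarrow> inv_word ainv (inv_word ainv w) = w"
  by (induction w) (auto simp: ainv_ainv)

definition words :: "nat \<Rightarrow> 'a list set" where
  "words n = {w \<in> lists A. length w \<le> n}"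

lemma finite_words: "finite (words n)"
  using finite_lists_length_le[OF finite_alphabet, of n]
  by (simp add: words_def lists_eq_set Collect_conj_eq)

lemma words_append: "u \<in> words m \<Longrightarrow> v \<in> words n \<Longrightarrow> u @ v \<in> words (m + n)"
  by (auto simp: words_def)

lemma words_inv: "u \<in> words m \<Longrightarrow> inv_word ainv u \<in> words m"
  by (auto simp: words_def)

lemma words_mono: "m \<le> n \<Longrightarrow> u \<in> words m \<Longrightarrow> u \<in> words n"
  by (auto simp: words_def)

lemma inv_word_concat: "inv_word ainv (concat ws) = concat (rev (map (inv_word ainv) ws))"
  by (induction ws) auto

end

section \<open>Finiteness of the action of a finitely generated monoid\<close>

lemma finite_image_if_factors:
  assumes "finite (f ` A)" "\<And>x y. \<lbrakk>x \<in> A; y \<in> A; f x = f y\<rbrakk> \<Longrightarrow> g x = g y"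
  shows "finite (g ` A)"
proof -
  have "g x = g (inv_into A f (f x))" if "x \<in> A" for x
    using that inv_into_into[OF imageI[OF that, of f]] f_inv_into_f[OF imageI[OF that, of f]]
    by (intro assms(2)) simp_all
  then have "g ` A \<subseteq> (\<lambda>t. g (inv_into A f t)) ` f ` A" by blast
  with assms(1) show ?thesis using finite_surj by blast
qed

text \<open>
An orbit with at most \<open>B\<close> points can be relabelled by numbers below \<open>B\<close>, which turns the action on it
into one of the finitely many maps from \<open>W\<close> to the self-maps of \<open>{..<B}\<close>. A word over \<open>W\<close> therefore acts
on all orbits as prescribed by its values under these finitely many maps.
\<close>

lemma finitely_many_actions_if_bounded_orbits:
  fixes g :: "'x \<Rightarrow> 's \<Rightarrow> 'x"
  assumes "finite W"
    and orbits: "\<And>x. x \<in> X \<Longrightarrow> finite (foldl g x ` lists W) \<and> card (foldl g x ` lists W) \<le> B"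
  shows "finite ((\<lambda>ws. restrict (\<lambda>x. foldl g x ws) X) ` lists W)"
proof -
  let ?E = "W \<rightarrow>\<^sub>E ({..<B} \<rightarrow>\<^sub>E {..<B})"
  \<comment> \<open>all values of a word in all actions on \<open>{..<B}\<close>, for every starting point\<close>
  define run where "run ws = (\<lambda>(f, m) \<in> ?E \<times> {..<B}. foldl (\<lambda>a s. f s a) m ws)" for ws :: "'s list"
  have closed: "foldl (\<lambda>a s. f s a) m ws \<in> {..<B}" if "f \<in> ?E" "m \<in> {..<B}" "ws \<in> lists W" for f m ws
    using that(2,3)
  proof (induction ws arbitrary: m)
    case (Cons s ws)
    have "f s m \<in> {..<B}" using that(1) Cons.prems by (meson Cons_in_lists_iff PiE_mem)
    then show ?case using Cons by simp
  qed simp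
  have "run ` lists W \<subseteq> (?E \<times> {..<B}) \<rightarrow>\<^sub>E {..<B}"
  proof (rule image_subsetI)
    fix ws assume "ws \<in> lists W"
    then show "run ws \<in> (?E \<times> {..<B}) \<rightarrow>\<^sub>E {..<B}"
      unfolding run_def restrict_PiE_iff using closed
      by (metis (no_types, lifting) SigmaE case_prod_conv)
  qed
  moreover have "finite ((?E \<times> {..<B}) \<rightarrow>\<^sub>E {..<B})"
    using assms(1) by (intro finite_PiE finite_cartesian_product) auto
  ultimately have fin: "finite (run ` lists W)" using finite_subset by blast
  have same: "foldl g x ws = foldl g x ws'"
    if "x \<in> X" "ws \<in> lists W" "ws' \<in> lists W" "run ws = run ws'" for x ws ws'
  proof -
    let ?O = "foldl g x ` lists W"
    have "\<exists>h. h ` ?O \<subseteq> {..<B} \<and> inj_on h ?O"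
      using card_le_inj[of ?O "{..<B}"] orbits[OF that(1)] by simp
    then obtain h where h: "inj_on h ?O" "h ` ?O \<subseteq> {..<B}" by blast
    \<comment> \<open>the action on the orbit, transported along \<open>h\<close>; fixing the other numbers is arbitrary\<close>
    define f where "f = (\<lambda>s \<in> W. \<lambda>m \<in> {..<B}. if m \<in> h ` ?O then h (g (inv_into ?O h m) s) else m)"
    have O_step: "g y s \<in> ?O" if "y \<in> ?O" "s \<in> W" for y s
    proof -
      from that(1) obtain us where "us \<in> lists W" "y = foldl g x us" by auto
      then show ?thesis using that(2) by (intro image_eqI[of _ _ "us @ [s]"]) auto
    qed
    have hO: "h y < B" if "y \<in> ?O" for y using h(2) that by auto
    have fE: "f \<in> ?E"
    proof (intro PiE_I)
      fix s m assume sm: "s \<in> W" "m \<in> {..<B}"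
      have "h (g (inv_into ?O h m) s) < B" if "m \<in> h ` ?O"
        using hO[OF O_step[OF inv_into_into[OF that] sm(1)]] .
      then show "f s m \<in> {..<B}" using sm by (simp add: f_def)
    qed (simp_all add: f_def)
    have f_step: "f s (h y) = h (g y s)" if "y \<in> ?O" "s \<in> W" for y s
      unfolding f_def using that hO[OF that(1)] inv_into_f_f[OF h(1) that(1)] by auto
    have simulate: "foldl (\<lambda>a s. f s a) (h y) us = h (foldl g y us)"
      if "y \<in> ?O" "us \<in> lists W" for y us
      using that
    proof (induction us arbitrary: y)
      case (Cons s us)
      then show ?case using f_step O_step by simp
    qed simp
    have x: "x \<in> ?O" by (rule image_eqI[of _ _ "[]"]) auto
    have "run ws (f, h x) = run ws' (f, h x)" using that(4) by simp
    then have "h (foldl g x ws) = h (foldl g x ws')"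
      using fE hO[OF x] simulate[OF x] that(2,3) by (simp add: run_def)
    then show ?thesis using h(1) that(2,3) by (meson image_eqI inj_onD)
  qed
  from fin show ?thesis
  proof (rule finite_image_if_factors)
    fix us ws assume "us \<in> lists W" "ws \<in> lists W" "run us = run ws"
    then show "restrict (\<lambda>x. foldl g x us) X = restrict (\<lambda>x. foldl g x ws) X"
      using same by (intro restrict_ext) metis
  qed
qed

section \<open>Actions of words and distance to a root\<close>

locale word_action = involutive_alphabet A ainv
  for A :: "'a set" and ainv :: "'a \<Rightarrow> 'a" +
  fixes V :: "'v set" and step :: "'v \<Rightarrow> 'a \<Rightarrow> 'v"
  assumes step_closed: "\<lbrakk>v \<in> V; a \<in> A\<rbrakk> \<Longrightarrow> step v a \<in> V"
    and step_step_ainv: "\<lbrakk>v \<in> V; a \<in> A\<rbrakk> \<Longrightarrow> step (step v a) (ainv a) = v"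
begin

abbreviation act :: "'v \<Rightarrow> 'a list \<Rightarrow> 'v" where
  "act \<equiv> foldl step"

lemma act_closed [simp, intro]: "v \<in> V \<Longrightarrow> w \<in> lists A \<Longrightarrow> act v w \<in> V"
  by (induction w arbitrary: v) (auto simp: step_closed)

lemma act_inv [simp]: "v \<in> V \<Longrightarrow> w \<in> lists A \<Longrightarrow> act (act v w) (inv_word ainv w) = v"
  by (induction w arbitrary: v) (auto simp: step_closed step_step_ainv)

lemma act_inv' [simp]: "v \<in> V \<Longrightarrow> w \<in> lists A \<Longrightarrow> act (act v (inv_word ainv w)) w = v"
  using act_inv[of v "inv_word ainv w"] by simp

lemma act_cancel:
  "\<lbrakk>act v w = act v' w; v \<in> V; v' \<in> V; w \<in> lists A\<rbrakk> \<Longrightarrow> v = v'"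
  by (metis act_inv)

end

locale rooted_action = word_action A ainv V step
  for A :: "'a set" and ainv :: "'a \<Rightarrow> 'a" and V :: "'v set" and step :: "'v \<Rightarrow> 'a \<Rightarrow> 'v" +
  fixes x0 :: 'v
  assumes root: "x0 \<in> V"
    and transitive: "v \<in> V \<Longrightarrow> \<exists>w \<in> lists A. act x0 w = v"
begin

definition depth :: "'v \<Rightarrow> nat" where
  "depth v = (LEAST n. \<exists>w \<in> lists A. length w = n \<and> act x0 w = v)"

lemma geodesic:
  assumes "v \<in> V"
  obtains w where "w \<in> lists A" "length w = depth v" "act x0 w = v"
proof -
  have "\<exists>n. \<exists>w \<in> lists A. length w = n \<and> act x0 w = v"
    using transitive[OF assms] by blast
  from LeastI_ex[OF this] show ?thesis using that unfolding depth_def by blast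
qed

lemma depth_le: "w \<in> lists A \<Longrightarrow> depth (act x0 w) \<le> length w"
  unfolding depth_def by (rule Least_le) blast

lemma depth_act_le:
  assumes "v \<in> V" "w \<in> lists A"
  shows "depth (act v w) \<le> depth v + length w"
proof -
  obtain u where "u \<in> lists A" "length u = depth v" "act x0 u = v"
    using geodesic[OF assms(1)] .
  with assms depth_le[of "u @ w"] show ?thesis by auto
qed

lemma depth_le_act:
  assumes "v \<in> V" "w \<in> lists A"
  shows "depth v \<le> depth (act v w) + length w"
  using depth_act_le[of "act v w" "inv_word ainv w"] assms by simp

text \<open>
Paths with a lower bound on the depth take the place of cones: they stay within one component of the
complement of a ball around the root.
\<close>

primrec stays :: "nat \<Rightarrow> 'v \<Rightarrow> 'a list \<Rightarrow> bool" where
  "stays n v [] \<longleftrightarrow> n \<le> depth v"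
| "stays n v (a # w) \<longleftrightarrow> n \<le> depth v \<and> stays n (step v a) w"

lemma stays_start: "stays n v w \<Longrightarrow> n \<le> depth v"
  by (cases w) auto

lemma stays_append: "stays n v (u @ w) \<longleftrightarrow> stays n v u \<and> stays n (act v u) w"
  by (induction u arbitrary: v) (auto dest: stays_start)

lemma stays_end: "stays n v w \<Longrightarrow> n \<le> depth (act v w)"
  by (induction w arbitrary: v) auto

lemma stays_mono: "stays n v w \<Longrightarrow> m \<le> n \<Longrightarrow> stays m v w"
  by (induction w arbitrary: v) auto

lemma stays_inv:
  "\<lbrakk>stays n v w; v \<in> V; w \<in> lists A\<rbrakk> \<Longrightarrow> stays n (act v w) (inv_word ainv w)"
  by (induction w arbitrary: v) (auto simp: stays_append step_closed step_step_ainv dest: stays_start)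

lemma stays_if_short:
  "\<lbrakk>v \<in> V; w \<in> lists A; n \<le> depth v - length w\<rbrakk> \<Longrightarrow> stays n v w"
proof (induction w arbitrary: v)
  case (Cons a w)
  then have "depth v \<le> depth (step v a) + 1"
    using depth_le_act[of v "[a]"] by simp
  then show ?case using Cons by (auto simp: step_closed)
qed simp

text \<open>
If the word is read in blocks of length at most \<open>l\<close>, then it suffices to control the depth at the
block boundaries, at the price of \<open>l\<close> levels.
\<close>

lemma stays_concat:
  assumes "p \<in> V" "set ws \<subseteq> lists A" "\<And>w. w \<in> set ws \<Longrightarrow> length w \<le> l"
    and "\<And>i. i \<le> length ws \<Longrightarrow> N \<le> depth (act p (concat (take i ws)))"
  shows "stays (N - l) p (concat ws)"
  using assms
proof (induction ws arbitrary: p)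
  case Nil
  then show ?case by force
next
  case (Cons w ws)
  have "stays (N - l) p w"
    using Cons.prems(1,2) Cons.prems(3)[of w] Cons.prems(4)[of 0]
    by (intro stays_if_short) auto
  moreover have "stays (N - l) (act p w) (concat ws)"
  proof (rule Cons.IH)
    show "N \<le> depth (act (act p w) (concat (take i ws)))" if "i \<le> length ws" for i
      using Cons.prems(4)[of "Suc i"] that by simp
  qed (use Cons.prems in auto)
  ultimately show ?case by (simp add: stays_append)
qed

lemma descend:
  assumes "v \<in> V" "n \<le> depth v"
  obtains g where "g \<in> lists A" "length g = depth v - n" "depth (act v g) = n" "stays n v g"
proof -
  obtain u where u: "u \<in> lists A" "length u = depth v" "act x0 u = v"
    using geodesic[OF assms(1)] .
  define u1 u2 where "u1 = take n u" and "u2 = drop n u"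
  have u12: "u1 \<in> lists A" "u2 \<in> lists A" "length u1 = n" "length u2 = depth v - n"
      "u = u1 @ u2"
    using u assms(2) unfolding u1_def u2_def by (auto dest: in_set_takeD in_set_dropD)
  let ?g = "inv_word ainv u2"
  have "v = act (act x0 u1) u2" using u(3) u12(5) by simp
  then have g: "act v ?g = act x0 u1" using act_inv[OF _ u12(2)] u12(1) root by blast
  have "depth (act v ?g) \<le> n" using depth_le[OF u12(1)] u12(3) g by simp
  moreover have "depth v \<le> depth (act v ?g) + (depth v - n)"
    using depth_le_act[OF assms(1), of ?g] u12 by simp
  ultimately show ?thesis
    using that[of ?g] stays_if_short[OF assms(1), of ?g n] u12 assms by auto
qed

end


section \<open>Excursions above a level\<close>

locale context_free_action = rooted_action A ainv V step x0
  for A :: "'a set" and ainv :: "'a \<Rightarrow> 'a" and V :: "'v set" and step :: "'v \<Rightarrow> 'a \<Rightarrow> 'v"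
    and x0 :: 'v +
  fixes P :: "('n, 'a) production set" and S :: 'n
  assumes finite_productions: "finite P"
    and grammar: "generates P [Nonterm S] w \<longleftrightarrow> w \<in> lists A \<and> act x0 w = x0"
begin

text \<open>
Taking a derivation apart replaces a nonterminal by a right-hand side, or splits off the first
symbol of a form and leaves a suffix. So the derivations of circuits at the root
lead only to these finitely many forms.
\<close>

definition forms :: "('n, 'a) symbol list set" where
  "forms = (\<Union>\<alpha> \<in> insert [Nonterm S] (snd ` P). set (suffixes \<alpha>))"

lemma finite_forms: "finite forms"
  using finite_productions by (simp add: forms_def)

lemma forms_start: "[Nonterm S] \<in> forms"
  by (simp add: forms_def)

lemma forms_rhs: "(X, \<alpha>) \<in> P \<Longrightarrow> \<alpha> \<in> forms"
  by (force simp: forms_def)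

lemma forms_Cons: "s # \<beta> \<in> forms \<Longrightarrow> \<beta> \<in> forms"
  by (auto simp: forms_def dest: suffix_ConsD)

lemma forms_Nil: "[] \<in> forms"
  by (simp add: forms_def)

text \<open>
Replacing a generated word by a shortest one bounds the distance between vertices that are joined by
a form, uniformly for all forms.
\<close>

definition K :: nat where
  "K = Max ((\<lambda>\<beta>. LEAST n. \<exists>w. generates P \<beta> w \<and> length w = n) ` forms)"

lemma short_yield:
  assumes "\<beta> \<in> forms" "generates P \<beta> w"
  obtains s where "generates P \<beta> s" "length s \<le> K"
proof -
  let ?n = "LEAST n. \<exists>w. generates P \<beta> w \<and> length w = n"
  have "\<exists>w. generates P \<beta> w \<and> length w = ?n"
    by (rule LeastI_ex) (use assms in blast)
  moreover have "?n \<le> K" unfolding K_def using assms finite_forms by (intro Max_ge) auto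
  ultimately show ?thesis using that by auto
qed

text \<open>
The key property of forms in a derivation: words generated at the same place of a circuit are
interchangeable, and the letters act injectively, so all of them join the same two vertices.
The form thereby carries information about words that do not occur in the circuit at hand.
\<close>

definition connects :: "('n, 'a) symbol list \<Rightarrow> 'v \<Rightarrow> 'v \<Rightarrow> bool" where
  "connects \<beta> y y' \<longleftrightarrow> (\<forall>w. generates P \<beta> w \<longrightarrow> w \<in> lists A \<and> act y w = y')"

lemma connects_prefix:
  assumes "connects (s # \<beta>) y y'" "generates P \<beta> w" "y \<in> V" "generates P [s] u"
  shows "connects [s] y (act y u)"
  unfolding connects_def
proof (intro allI impI)
  fix u' assume "generates P [s] u'"
  then have "generates P (s # \<beta>) (u' @ w)" "generates P (s # \<beta>) (u @ w)"
    using generates_append[OF _ assms(2), of "[s]"] assms(4) by auto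
  with assms(1) have "u' @ w \<in> lists A" "u @ w \<in> lists A"
      "act (act y u') w = act (act y u) w"
    unfolding connects_def by (metis foldl_append)+
  with assms(3) show "u' \<in> lists A \<and> act y u' = act y u"
    by (auto dest!: act_cancel)
qed

lemma connects_suffix:
  assumes "connects (s # \<beta>) y y'" "generates P [s] u"
  shows "connects \<beta> (act y u) y'"
  unfolding connects_def
proof (intro allI impI)
  fix w assume "generates P \<beta> w"
  then have "generates P (s # \<beta>) (u @ w)"
    using generates_append[OF assms(2)] by auto
  with assms(1) show "w \<in> lists A \<and> act (act y u) w = y'"
    unfolding connects_def by (auto dest!: spec)
qed

lemma connects_rhs: "(X, \<alpha>) \<in> P \<Longrightarrow> connects [Nonterm X] y y' \<Longrightarrow> connects \<alpha> y y'"
  unfolding connects_def using generates_singleton by metis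

text \<open>
Two vertices that are joined by a form are joined by its short word.
\<close>

lemma connects_close:
  assumes "\<beta> \<in> forms" "generates P \<beta> w" "connects \<beta> y y'" "y \<in> V"
  shows "depth y \<le> depth y' + K" "depth y' \<le> depth y + K"
proof -
  obtain s where "generates P \<beta> s" "length s \<le> K" using short_yield[OF assms(1,2)] .
  with assms(3,4) depth_act_le[of y s] depth_le_act[of y s]
  show "depth y \<le> depth y' + K" "depth y' \<le> depth y + K" unfolding connects_def by force+
qed

text \<open>
The path \<open>c\<close> from \<open>f\<close>, extended by at most \<open>K\<close> letters at both ends, is certified by a form.
The certificate has a bounded description in terms of \<open>f\<close> and the end of \<open>c\<close>, however long \<open>c\<close> is.
\<close>

definition crosses :: "'v \<Rightarrow> 'a list \<Rightarrow> bool" where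
  "crosses f c \<longleftrightarrow> (\<exists>\<gamma> \<in> forms. \<exists>u \<in> words K. \<exists>v \<in> words K.
     generates P \<gamma> (u @ c @ v) \<and> connects \<gamma> (act f (inv_word ainv u)) (act (act f c) v))"

lemma crosses_Nil: "f \<in> V \<Longrightarrow> crosses f []"
  unfolding crosses_def
  by (intro bexI[of _ "[]"])
    (auto simp: forms_Nil words_def connects_def intro: generates.Nil elim: generates_NilE)

text \<open>
Here \<open>u\<close> and \<open>v\<close> are pieces of geodesics that lead from low vertices up to level \<open>n\<close> and back down.
Descend in the derivation as long as \<open>c\<close> lies within the part of the word that comes from the first
symbol or within the rest. When \<open>c\<close> is split for the first time, the splitting point lies at level \<open>n\<close>
or higher and is joined to the low ends of \<open>u\<close> and \<open>v\<close> by forms, hence by paths of length at most \<open>K\<close>;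
so \<open>u\<close> and \<open>v\<close> have length at most \<open>K\<close>.
\<close>

lemma crosses_if_generated:
  assumes "generates P \<beta> w" "\<beta> \<in> forms" "w = u @ c @ v" "y \<in> V" "connects \<beta> y y'"
    and "stays n (act y u) c" "depth y + length u \<le> n" "depth y' + length v \<le> n"
  shows "crosses (act y u) c"
  using assms
proof (induction arbitrary: u v y y' rule: generates.induct)
  case Nil
  then show ?case using crosses_Nil by simp
next
  case (Term \<beta> w a)
  have gen: "generates P (Term a # \<beta>) (u @ c @ v)"
    using Term.hyps Term.prems(2) generates.Term by metis
  have uv: "u \<in> lists A" "c \<in> lists A" "v \<in> lists A" "act (act (act y u) c) v = y'"
    using gen Term.prems(4) unfolding connects_def by auto
  have gena: "generates P [Term a] [a]" by (intro generates.intros)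
  have rest: "connects \<beta> (act y [a]) y'" "\<beta> \<in> forms"
    using connects_suffix[OF Term.prems(4) gena] Term.prems(1) forms_Cons by auto
  have a: "act y [a] \<in> V" "a \<in> A"
    using gen Term.prems(2,3) uv by (auto simp: Cons_eq_append_conv step_closed)
  show ?case
  proof (cases u)
    case (Cons b u')
    then have "u = a # u'" "w = u' @ c @ v" using Term.prems(2) by auto
    moreover have "depth (act y [a]) + length u' \<le> n"
      using depth_act_le[of y "[a]"] Term.prems(3,6) a calculation by simp
    ultimately show ?thesis
      using Term.IH[of u' v "act y [a]" y'] Term.prems rest a by simp
  next
    case Nil
    show ?thesis
    proof (cases c)
      case Nil
      then show ?thesis using crosses_Nil Term.prems(3) uv by simp
    next
      case (Cons b c')
      then have c: "c = a # c'" "w = c' @ v" using Term.prems(2) \<open>u = []\<close> by auto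
      have "n \<le> depth (act y [a])"
        using Term.prems(5) c \<open>u = []\<close> stays_start by auto
      also have "\<dots> \<le> depth y' + K"
        using connects_close(1)[OF rest(2) Term.hyps rest(1) a(1)] .
      finally have "length v \<le> K" using Term.prems(7) by linarith
      then show ?thesis unfolding crosses_def
        using gen Term.prems(1,4) uv \<open>u = []\<close>
        by (intro bexI[of _ "Term a # \<beta>"] bexI[of _ "[]"] bexI[of _ v]) (auto simp: words_def)
    qed
  qed
next
  case (Nonterm X \<alpha> w1 \<beta> w2)
  have gen: "generates P (Nonterm X # \<beta>) (u @ c @ v)"
    using Nonterm.hyps Nonterm.prems(2) generates.Nonterm by metis
  have uv: "u \<in> lists A" "c \<in> lists A" "v \<in> lists A" "act (act (act y u) c) v = y'"
    using gen Nonterm.prems(4) unfolding connects_def by auto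
  have genX: "generates P [Nonterm X] w1" using Nonterm.hyps(1,2) generates_singleton by metis
  have rest: "connects \<beta> (act y w1) y'" "\<beta> \<in> forms"
    using connects_suffix[OF Nonterm.prems(4) genX] Nonterm.prems(1) forms_Cons by auto
  have first: "connects \<alpha> y (act y w1)" "\<alpha> \<in> forms"
    using connects_prefix[OF Nonterm.prems(4) Nonterm.hyps(3) Nonterm.prems(3) genX]
      Nonterm.hyps(1) connects_rhs forms_rhs by auto
  have w12: "w1 \<in> lists A" "w2 \<in> lists A" "act y w1 \<in> V"
    using Nonterm.prems(2,3) uv(1-3) append_in_lists_conv by (metis act_closed)+
  consider (left) u' where "u = w1 @ u'" "w2 = u' @ c @ v"
    | (middle) c1 c2 where "w1 = u @ c1" "c = c1 @ c2" "w2 = c2 @ v"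
    | (right) v1 where "w1 = u @ c @ v1" "v = v1 @ w2"
    using Nonterm.prems(2) by (auto simp: append_eq_append_conv2)
  then show ?case
  proof cases
    case left
    have "depth (act y w1) + length u' \<le> n"
      using depth_act_le[OF Nonterm.prems(3) w12(1)] Nonterm.prems(6) left by simp
    then show ?thesis
      using Nonterm.IH(2)[of u' v "act y w1" y'] Nonterm.prems rest w12 left by simp
  next
    case right
    have "depth (act y w1) + length v1 \<le> n"
      using depth_le_act[OF w12(3) w12(2)] Nonterm.prems(7) right uv(4) by simp
    then show ?thesis
      using Nonterm.IH(1)[of u v1 y "act y w1"] Nonterm.prems first right by simp
  next
    case middle
    have "n \<le> depth (act y w1)"
      using Nonterm.prems(5) middle by (auto simp: stays_append dest: stays_end)
    then have "length v \<le> K" "length u \<le> K"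
      using connects_close(1)[OF rest(2) Nonterm.hyps(3) rest(1) w12(3)] Nonterm.prems(6,7)
        connects_close(2)[OF first(2) Nonterm.hyps(2) first(1) Nonterm.prems(3)]
      by linarith+
    then show ?thesis unfolding crosses_def
      using gen Nonterm.prems(1,3,4) uv
      by (intro bexI[of _ "Nonterm X # \<beta>"] bexI[of _ u] bexI[of _ v]) (auto simp: words_def)
  qed
qed

text \<open>
A path above a level that starts and ends on that level is completed to a circuit at the root by
geodesics.
\<close>

lemma crossing:
  assumes "f \<in> V" "depth f = n" "c \<in> lists A" "stays n f c" "depth (act f c) = n"
  shows "crosses f c"
proof -
  obtain u where u: "u \<in> lists A" "length u = n" "act x0 u = f"
    using geodesic[OF assms(1)] assms(2) by metis
  obtain v where v: "v \<in> lists A" "length v = n" "act x0 v = act f c"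
    using geodesic[of "act f c"] assms by (metis act_closed)
  have "generates P [Nonterm S] (u @ c @ inv_word ainv v)"
    using u v assms(3) root by (simp add: grammar) (metis act_inv)
  moreover have "depth x0 = 0" using depth_le[of "[]"] by simp
  moreover have "connects [Nonterm S] x0 x0" by (simp add: connects_def grammar)
  ultimately show ?thesis
    using crosses_if_generated[of "[Nonterm S]" _ u c "inv_word ainv v" x0 x0 n] u v assms forms_start root
    by simp
qed

text \<open>
The short word of the certifying form replaces the path, whatever its length.
\<close>

lemma level_diameter:
  assumes "f \<in> V" "depth f = n" "c \<in> lists A" "stays n f c" "depth (act f c) = n"
  obtains z where "z \<in> words (3 * K)" "act f z = act f c"
proof -
  from crossing[OF assms] obtain \<gamma> u v where *: "\<gamma> \<in> forms" "u \<in> words K" "v \<in> words K"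
      "generates P \<gamma> (u @ c @ v)" "connects \<gamma> (act f (inv_word ainv u)) (act (act f c) v)"
    unfolding crosses_def by blast
  obtain s where s: "generates P \<gamma> s" "length s \<le> K" using short_yield[OF *(1,4)] .
  with *(5) have s': "s \<in> words K" "act (act f (inv_word ainv u)) s = act (act f c) v"
    unfolding connects_def by (auto simp: words_def)
  let ?z = "inv_word ainv u @ s @ inv_word ainv v"
  have "?z \<in> words (K + (K + K))" using * s' by (intro words_append words_inv)
  moreover have "act f ?z = act f c"
    using * s' assms(1,3) by (simp add: words_def)
  ultimately show ?thesis using that by (simp add: numeral_3_eq_3)
qed

section \<open>Local types of vertices\<close>

text \<open>
The forms that join points near \<open>p\<close>, and the depths of the points near \<open>p\<close> relative to \<open>p\<close>. All points
are named by words read from \<open>p\<close>, so that types of different vertices can be compared. Equality of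
types is the substitute for isomorphism of the cones above two vertices.
\<close>

definition local_type :: "nat \<Rightarrow> 'v \<Rightarrow> ('a list \<times> ('n, 'a) symbol list \<times> 'a list) set \<times> ('a list \<times> int) set" where
  "local_type R p =
     ({(u, \<gamma>, v). u \<in> words R \<and> \<gamma> \<in> forms \<and> v \<in> words R \<and> connects \<gamma> (act p u) (act p v)},
      (\<lambda>z. (z, int (depth (act p z)) - int (depth p))) ` words R)"

definition type_universe :: "nat \<Rightarrow> (('a list \<times> ('n, 'a) symbol list \<times> 'a list) set \<times> ('a list \<times> int) set) set" where
  "type_universe R =
     Pow (words R \<times> forms \<times> words R) \<times> Pow (words R \<times> {- int R .. int R})"

lemma finite_type_universe: "finite (type_universe R)"
  by (simp add: type_universe_def finite_words finite_forms)

lemma local_type_in_universe: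
  assumes "p \<in> V"
  shows "local_type R p \<in> type_universe R"
proof -
  have "int (depth (act p z)) - int (depth p) \<in> {- int R .. int R}" if "z \<in> words R" for z
    using that depth_act_le[OF assms, of z] depth_le_act[OF assms, of z]
    by (auto simp: words_def)
  then show ?thesis by (auto simp: local_type_def type_universe_def)
qed

lemma local_type_connects:
  assumes "local_type R p = local_type R p'" "u \<in> words R" "v \<in> words R" "\<gamma> \<in> forms"
  shows "connects \<gamma> (act p u) (act p v) \<longleftrightarrow> connects \<gamma> (act p' u) (act p' v)"
proof -
  have "(u, \<gamma>, v) \<in> fst (local_type R p) \<longleftrightarrow> (u, \<gamma>, v) \<in> fst (local_type R p')"
    using assms(1) by simp
  then show ?thesis using assms(2-4) by (simp add: local_type_def)
qed

lemma local_type_depth: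
  assumes "local_type R p = local_type R p'" "z \<in> words R"
  shows "depth (act p z) + depth p' = depth (act p' z) + depth p"
proof -
  have "(z, int (depth (act p z)) - int (depth p)) \<in> snd (local_type R p')"
    using assms unfolding local_type_def by auto
  then show ?thesis by (auto simp: local_type_def)
qed

text \<open>
The certificate of the path \<open>c\<close> is part of the type of \<open>p\<close>, so it certifies the same word at \<open>p'\<close>.
\<close>

lemma transfer_circuit:
  assumes "local_type R p = local_type R p'" "p \<in> V" "p' \<in> V"
    and "z \<in> words m" "z' \<in> words m" "m + K \<le> R"
    and "c \<in> lists A" "stays n (act p z) c" "act (act p z) c = act p z'"
    and "depth (act p z) = n" "depth (act p z') = n"
  shows "act (act p' z) c = act p' z'"
proof -
  have zA: "z \<in> lists A" "z' \<in> lists A" using assms(4,5) by (auto simp: words_def)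
  have "crosses (act p z) c"
    by (rule crossing) (use assms zA in auto)
  then obtain \<gamma> u v where *: "\<gamma> \<in> forms" "u \<in> words K" "v \<in> words K"
      "generates P \<gamma> (u @ c @ v)"
      "connects \<gamma> (act p (z @ inv_word ainv u)) (act p (z' @ v))"
    unfolding crosses_def using assms(9) by auto
  have "z @ inv_word ainv u \<in> words R" "z' @ v \<in> words R"
    using words_append[OF assms(4) words_inv[OF *(2)]] words_append[OF assms(5) *(3)]
      words_mono[OF assms(6)] by auto
  then have "connects \<gamma> (act p' (z @ inv_word ainv u)) (act p' (z' @ v))"
    using local_type_connects[OF assms(1)] * by blast
  then have "act (act (act (act p' z) (inv_word ainv u)) u) (c @ v) = act (act p' z') v"
    using *(4) unfolding connects_def by (metis foldl_append)
  moreover have uv: "u \<in> lists A" "v \<in> lists A" using *(2,3) by (auto simp: words_def)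
  ultimately have "act (act (act p' z) c) v = act (act p' z') v"
    using act_inv'[OF act_closed[OF assms(3) zA(1)] uv(1)] by simp
  then show ?thesis
    using act_cancel uv(2) zA assms(3,7) by blast
qed

text \<open>
Prefixed by a geodesic from level \<open>n\<close> up to \<open>p\<close>, the path becomes an excursion that starts and ends on
level \<open>n\<close>. So its end has a name \<open>z\<close> of bounded length, and the excursion is covered by the type of \<open>p\<close>.
\<close>

lemma boundary_point:
  assumes "local_type R p = local_type R p'" "p \<in> V" "p' \<in> V"
    and "depth p = n + e" "e + 4 * K \<le> R"
    and "c \<in> lists A" "stays n p c" "depth (act p c) = n"
  obtains z where "z \<in> words (e + 3 * K)" "act p c = act p z" "act p' c = act p' z"
proof -
  obtain g where g: "g \<in> lists A" "length g = e" "depth (act p g) = n" "stays n p g"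
    using descend[OF assms(2), of n] assms(4) by auto
  have circuit: "act (act p g) (inv_word ainv g @ c) = act p c"
      "stays n (act p g) (inv_word ainv g @ c)"
    using g assms stays_inv[OF g(4)] by (auto simp: stays_append)
  obtain z1 where z1: "z1 \<in> words (3 * K)" "act (act p g) z1 = act p c"
    using level_diameter[of "act p g" n "inv_word ainv g @ c"] g circuit assms
    by (metis act_closed append_in_lists_conv inv_word_closed)
  have z: "g @ z1 \<in> words (e + 3 * K)" "g \<in> words (e + 3 * K)"
    using g z1 by (auto simp: words_def)
  have "act (act p' g) (inv_word ainv g @ c) = act p' (g @ z1)"
    by (rule transfer_circuit[OF assms(1-3) z(2,1)]) (use g z1 circuit assms in auto)
  then show ?thesis using that[OF z(1)] z1 g assms by simp
qed

text \<open>
Continue the path by a geodesic down to level \<open>n\<close>. The point reached there is near \<open>p\<close>, so the type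
records its depth, and the same continuation from \<open>p'\<close> arrives on level \<open>n'\<close>.
\<close>

lemma relative_depth_le:
  assumes "local_type R p = local_type R p'" "p \<in> V" "p' \<in> V"
    and "depth p = n + e" "depth p' = n' + e" "e + 4 * K \<le> R"
    and "c \<in> lists A" "stays n p c"
  shows "depth (act p' c) + n \<le> depth (act p c) + n'"
proof -
  have pc: "act p c \<in> V" "act p' c \<in> V" "n \<le> depth (act p c)"
    using assms stays_end by auto
  obtain g where g: "g \<in> lists A" "length g = depth (act p c) - n" "depth (act (act p c) g) = n"
      "stays n (act p c) g"
    using descend[OF pc(1,3)] .
  obtain z where z: "z \<in> words (e + 3 * K)" "act p (c @ g) = act p z"
      "act p' (c @ g) = act p' z"
    using boundary_point[OF assms(1-4,6), of "c @ g"] g assms(7,8) by (auto simp: stays_append)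
  have "depth (act p z) + depth p' = depth (act p' z) + depth p"
    using local_type_depth[OF assms(1)] words_mono[OF _ z(1)] assms(6) by simp
  moreover have "depth (act p z) = n" using z(2) g(3) by simp
  ultimately have "depth (act p' z) = n'" using assms(4,5) by simp
  then show ?thesis
    using depth_le_act[OF pc(2) g(1)] z(3) g(2) pc(3) by simp
qed

text \<open>
The inequality holds in both directions as soon as the path from \<open>p'\<close> is known to stay above level
\<open>n'\<close>. It cannot fall below at a letter: just before, the path from \<open>p\<close> would be on level \<open>n\<close>, hence at a
point near \<open>p\<close>, where the types agree on depths.
\<close>

lemma relative_depth_eq:
  assumes "local_type R p = local_type R p'" "p \<in> V" "p' \<in> V"
    and "depth p = n + e" "depth p' = n' + e" "e + 4 * K + 1 \<le> R"
    and "c \<in> lists A" "stays n p c"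
  shows "stays n' p' c \<and> depth (act p' c) + n = depth (act p c) + n'"
  using assms(7,8)
proof (induction c rule: rev_induct)
  case Nil
  then show ?case using assms by simp
next
  case (snoc a c)
  have pc: "stays n p c" "c \<in> lists A" "a \<in> A" "n \<le> depth (act p c)"
      "n \<le> depth (act p (c @ [a]))"
    using snoc.prems stays_end by (auto simp: stays_append)
  have IH: "stays n' p' c" "depth (act p' c) + n = depth (act p c) + n'"
    using snoc.IH pc by auto
  have "n' \<le> depth (act p' (c @ [a]))"
  proof (cases "depth (act p c) = n")
    case False
    then have "n' < depth (act p' c)" using IH pc(4) by linarith
    then show ?thesis using depth_le_act[of "act p' c" "[a]"] pc assms(3) by simp
  next
    case True
    obtain z where z: "z \<in> words (e + 3 * K)" "act p c = act p z" "act p' c = act p' z"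
      using boundary_point[OF assms(1-4) _ pc(2,1) True] assms(6) by auto
    have "z @ [a] \<in> words R" using z(1) pc(3) assms(6) by (auto simp: words_def)
    then have "depth (act p (c @ [a])) + depth p' = depth (act p' (c @ [a])) + depth p"
      using local_type_depth[OF assms(1), of "z @ [a]"] z by simp
    then show ?thesis using pc(5) assms(4,5) by linarith
  qed
  then have "stays n' p' (c @ [a])"
    using IH(1) stays_end[OF IH(1)] by (simp add: stays_append)
  then show ?case
    using relative_depth_le[OF assms(1-5) _ snoc.prems]
      relative_depth_le[OF assms(1)[symmetric] assms(3,2,5,4) _ snoc.prems(1)] assms(6)
    by fastforce
qed

end

section \<open>Torsion forces bounded orbits\<close>

lemma last_visit:
  fixes D :: "nat \<Rightarrow> nat"
  assumes "D 0 \<le> h" "h < D m"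
  obtains i where "i < m" "D i \<le> h" "\<And>j. i < j \<Longrightarrow> j \<le> m \<Longrightarrow> h < D j"
proof -
  let ?I = "{i. i \<le> m \<and> D i \<le> h}"
  have fin: "finite ?I" "?I \<noteq> {}" using assms(1) by auto
  have "Max ?I \<in> ?I" using Max_in[OF fin] .
  moreover have "h < D j" if "Max ?I < j" "j \<le> m" for j
  proof (rule ccontr)
    assume "\<not> h < D j"
    then have "j \<le> Max ?I" using that(2) by (intro Max_ge[OF fin(1)]) simp
    then show False using that(1) by simp
  qed
  ultimately show ?thesis using that[of "Max ?I"] assms(2) by (auto simp: order.order_iff_strict)
qed

context context_free_action
begin

text \<open>
The word \<open>w\<close> leads from \<open>p\<close> to a vertex of greater depth and the same type, so relative depths along
the powers of \<open>w\<close> are the same from both vertices. Hence each further reading of \<open>w\<close> gains the same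
amount of depth, and the powers of \<open>w\<close> never return to \<open>p\<close>.
\<close>

lemma ascending_word_not_torsion:
  assumes "local_type R p = local_type R (act p w)" "p \<in> V" "w \<in> lists A"
    and "depth p = n + e" "e + 4 * K + 1 \<le> R"
    and "stays n p w" "depth p < depth (act p w)" "0 < t"
  shows "act p (concat (replicate t w)) \<noteq> p"
proof -
  define \<delta> where "\<delta> = depth (act p w) - depth p"
  have *: "stays n p (concat (replicate i w)) \<and>
      depth (act p (concat (replicate i w))) = depth p + i * \<delta>" for i
  proof (induction i)
    case (Suc i)
    have "stays (n + \<delta>) (act p w) (concat (replicate i w)) \<and>
        depth (act (act p w) (concat (replicate i w))) + n
          = depth (act p (concat (replicate i w))) + (n + \<delta>)"
      by (rule relative_depth_eq[OF assms(1,2)])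
        (use assms Suc in \<open>auto simp: \<delta>_def\<close>)
    then show ?case
      using Suc assms(6) stays_mono[of "n + \<delta>" _ _ n] by (simp add: stays_append)
  qed (use assms in simp)
  have "0 < t * \<delta>" using assms(7,8) by (simp add: \<delta>_def)
  then show ?thesis using *[of t] by force
qed

text \<open>
Suppose that a product of words from \<open>W\<close> leads from \<open>p\<close> far up. For each of the levels
\<open>depth p + j * l\<close> consider the last block boundary that is not above that level. There are more levels
than types, so two of these boundaries have the same type. The word between them increases the depth and does not
fall more than \<open>l\<close> below its start, so it is a word of infinite order.
\<close>

lemma torsion_depth_bounded:
  assumes W: "W \<subseteq> lists A" "\<And>w. w \<in> W \<Longrightarrow> length w \<le> l"
    and torsion: "\<And>ws. ws \<in> lists W \<Longrightarrow>
      \<exists>t>0. \<forall>v \<in> V. act v (concat (replicate t (concat ws))) = v"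
    and p: "p \<in> V" and ws: "ws \<in> lists W"
  shows "depth (act p (concat ws)) \<le> depth p + card (type_universe (l + 4 * K + 1)) * l"
proof (rule ccontr)
  define R where "R = l + 4 * K + 1"
  define M where "M = card (type_universe R)"
  define q where "q i = act p (concat (take i ws))" for i
  assume "\<not> ?thesis"
  then have deep: "depth p + M * l < depth (q (length ws))" by (simp add: q_def M_def R_def)
  have inA: "concat (take i us) \<in> lists A" if "us \<in> lists W" for us i
    using that W(1) by (force dest: in_set_takeD)
  have qV: "q i \<in> V" for i using inA[OF ws] p by (simp add: q_def del: in_lists_conv_set)
  have q_step: "depth (q (Suc i)) \<le> depth (q i) + l" if "i < length ws" for i
  proof -
    have "ws ! i \<in> W" using ws that by auto
    moreover have "q (Suc i) = act (q i) (ws ! i)"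
      using that by (simp add: q_def take_Suc_conv_app_nth)
    ultimately show ?thesis
      using depth_act_le[OF qV[of i], of "ws ! i"] W(1) W(2)[of "ws ! i"] by force
  qed
  have "\<exists>i. i < length ws \<and> depth (q i) \<le> depth p + j * l \<and>
      (\<forall>i'. i < i' \<longrightarrow> i' \<le> length ws \<longrightarrow> depth p + j * l < depth (q i'))" if "j \<in> {..M}" for j
  proof -
    have "j * l \<le> M * l" using that by simp
    then have "depth p + j * l < depth (q (length ws))" using deep by linarith
    then show ?thesis
      using last_visit[of "\<lambda>i. depth (q i)" "depth p + j * l" "length ws"]
      by (metis (no_types, lifting) concat.simps(1) foldl_Nil le_add1 q_def take0)
  qed
  then obtain idx where idx: "\<And>j. j \<in> {..M} \<Longrightarrow> idx j < length ws"
      "\<And>j. j \<in> {..M} \<Longrightarrow> depth (q (idx j)) \<le> depth p + j * l"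
      "\<And>j i'. j \<in> {..M} \<Longrightarrow> idx j < i' \<Longrightarrow> i' \<le> length ws \<Longrightarrow> depth p + j * l < depth (q i')"
    by metis
  have idx_gt: "depth p + j * l < depth (q (idx j)) + l" if "j \<in> {..M}" for j
    using idx(3)[OF that, of "Suc (idx j)"] q_step[OF idx(1)[OF that]] idx(1)[OF that] by simp
  have "\<not> inj_on (\<lambda>j. local_type R (q (idx j))) {..M}"
  proof (rule pigeonhole)
    have "card ((\<lambda>j. local_type R (q (idx j))) ` {..M}) \<le> M"
      unfolding M_def using local_type_in_universe[OF qV]
      by (intro card_mono finite_type_universe) auto
    then show "card ((\<lambda>j. local_type R (q (idx j))) ` {..M}) < card {..M}" by simp
  qed
  then obtain j j' where j: "j \<in> {..M}" "j' \<in> {..M}" "j < j'"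
      "local_type R (q (idx j)) = local_type R (q (idx j'))"
    unfolding inj_on_def by (metis linorder_neqE_nat)
  have "j * l + l \<le> j' * l" using j(3) mult_le_mono1[of "Suc j" j' l] by simp
  then have up: "depth p + j * l < depth (q (idx j'))" using idx_gt[OF j(2)] by linarith
  have le: "idx j \<le> idx j'"
  proof (rule ccontr)
    assume "\<not> idx j \<le> idx j'"
    then have "depth p + j' * l < depth (q (idx j))" using idx(1)[OF j(1)] idx(3)[OF j(2)] by simp
    moreover have "j * l \<le> j' * l" using j(3) by simp
    ultimately show False using idx(2)[OF j(1)] by linarith
  qed
  define us where "us = take (idx j' - idx j) (drop (idx j) ws)"
  have us: "us \<in> lists W" using ws unfolding us_def by (auto dest: in_set_takeD in_set_dropD)
  have us_take: "act (q (idx j)) (concat (take i us)) = q (idx j + i)" if "i \<le> length us" for i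
  proof -
    have "take i us = take i (drop (idx j) ws)" using that by (simp add: us_def)
    then show ?thesis by (simp add: q_def take_add)
  qed
  have len: "length us = idx j' - idx j" using idx(1)[OF j(2)] by (simp add: us_def)
  have arrive: "act (q (idx j)) (concat us) = q (idx j')" using us_take[of "length us"] len le by simp
  have "stays (depth (q (idx j)) - l) (q (idx j)) (concat us)"
  proof (rule stays_concat[OF qV])
    fix i assume i: "i \<le> length us"
    show "depth (q (idx j)) \<le> depth (act (q (idx j)) (concat (take i us)))"
    proof (cases "i = 0")
      case False
      then have "depth p + j * l < depth (q (idx j + i))"
        using idx(1)[OF j(2)] i len le by (intro idx(3)[OF j(1)]) auto
      then show ?thesis using us_take[OF i] idx(2)[OF j(1)] by simp
    qed simp
  qed (use us W in auto)
  then have "act (q (idx j)) (concat (replicate t (concat us))) \<noteq> q (idx j)" if "t > 0" for t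
    using that j(4) arrive up idx(2)[OF j(1)] inA[OF us, of "length us"] qV
    by (intro ascending_word_not_torsion[where R = R and e = "min l (depth (q (idx j)))"
          and n = "depth (q (idx j)) - l"]) (auto simp: R_def)
  then show False using torsion[OF us] qV by blast
qed

text \<open>
Choose a vertex \<open>p\<close> of least depth in the orbit. All paths within the orbit then stay above level
\<open>depth p - l\<close>, and all orbit points have depth at most \<open>depth p + M\<close>. Descending from any orbit point to
that level ends near \<open>p\<close>, so the orbit lies in a ball around \<open>p\<close> whose radius does not depend on the orbit.
\<close>

lemma torsion_orbits_bounded:
  assumes W: "finite W" "W \<subseteq> lists A" "\<And>w. w \<in> W \<Longrightarrow> inv_word ainv w \<in> W"
    and torsion: "\<And>ws. ws \<in> lists W \<Longrightarrow>
      \<exists>t>0. \<forall>v \<in> V. act v (concat (replicate t (concat ws))) = v"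
  shows "\<exists>B. \<forall>v \<in> V. finite ((\<lambda>ws. act v (concat ws)) ` lists W)
    \<and> card ((\<lambda>ws. act v (concat ws)) ` lists W) \<le> B"
proof -
  define l where "l = Max (insert 0 (length ` W))"
  have l: "length w \<le> l" if "w \<in> W" for w using that W(1) by (simp add: l_def)
  define M where "M = card (type_universe (l + 4 * K + 1)) * l"
  define r where "r = l + 3 * K + (M + l)"
  have inA: "concat us \<in> lists A" if "us \<in> lists W" for us
    using that W(2) by force
  have "\<exists>p. (\<lambda>ws. act v (concat ws)) ` lists W \<subseteq> act p ` words r" if v: "v \<in> V" for v
  proof -
    let ?O = "(\<lambda>ws. act v (concat ws)) ` lists W"
    obtain p where p: "p \<in> ?O" "\<And>q. q \<in> ?O \<Longrightarrow> depth p \<le> depth q"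
      using ex_has_least_nat[of "\<lambda>q. q \<in> ?O" v depth] by (metis (no_types, lifting) concat.simps(1)
          foldl_Nil image_eqI lists.Nil)
    then obtain us where us: "us \<in> lists W" "p = act v (concat us)" by auto
    have pV: "p \<in> V" using us inA v by blast
    let ?us = "rev (map (inv_word ainv) us)"
    have return: "?us \<in> lists W" "act p (concat ?us) = v"
      using us(1) W(3) act_inv[OF v inA[OF us(1)]] us(2) inv_word_concat by auto
    have "act v (concat ws) \<in> act p ` words r" if ws: "ws \<in> lists W" for ws
    proof -
      let ?vs = "?us @ ws" and ?n = "depth p - l"
      have vs: "?vs \<in> lists W" "act p (concat ?vs) = act v (concat ws)" using return ws by auto
      define c where "c = concat ?vs"
      have c: "c \<in> lists A" "act p c = act v (concat ws)"
        using inA[OF vs(1)] vs(2) by (simp_all only: c_def)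
      have stay: "stays ?n p c" unfolding c_def
      proof (rule stays_concat[OF pV])
        fix i
        have "us @ take i ?vs \<in> lists W"
          using us(1) vs(1) by (auto dest!: in_set_takeD)
        then have "act v (concat (us @ take i ?vs)) \<in> ?O" by blast
        then show "depth p \<le> depth (act p (concat (take i ?vs)))" using p(2) us(2) by simp
      next
        have sub: "set ?vs \<subseteq> W" using vs(1) unfolding lists_eq_set by blast
        then show "set ?vs \<subseteq> lists A" using W(2) by (rule order_trans)
        show "length w \<le> l" if "w \<in> set ?vs" for w using sub that l by blast
      qed
      have pc: "act p c \<in> V" using pV c(1) by simp
      obtain g where g: "g \<in> lists A" "length g = depth (act p c) - ?n"
          "depth (act (act p c) g) = ?n" "stays ?n (act p c) g"
        using descend[OF pc stays_end[OF stay]] .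
      have cg: "c @ g \<in> lists A" "stays ?n p (c @ g)" "depth (act p (c @ g)) = ?n"
        using c(1) g stay by (simp_all add: stays_append)
      have "depth p = ?n + min l (depth p)" by simp
      then obtain z where z: "z \<in> words (min l (depth p) + 3 * K)" "act p (c @ g) = act p z"
        using boundary_point[OF refl pV pV _ order_refl cg] by blast
      have "depth (act p c) \<le> depth p + M"
        unfolding M_def c_def by (rule torsion_depth_bounded[OF W(2) l torsion pV vs(1)])
      then have "inv_word ainv g \<in> words (M + l)" using g(1,2) by (auto simp: words_def)
      then have "z @ inv_word ainv g \<in> words (min l (depth p) + 3 * K + (M + l))"
        using words_append[OF z(1)] by blast
      then have "z @ inv_word ainv g \<in> words r"
        by (rule words_mono[rotated]) (simp add: r_def)
      moreover have "act p (z @ inv_word ainv g) = act p c"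
        using act_inv[OF pc g(1)] z(2) by simp
      ultimately show ?thesis using c(2) by (metis image_eqI)
    qed
    then show ?thesis by blast
  qed
  then have "finite ((\<lambda>ws. act v (concat ws)) ` lists W)
      \<and> card ((\<lambda>ws. act v (concat ws)) ` lists W) \<le> card (words r)" if "v \<in> V" for v
    using that surj_card_le[OF finite_words] finite_surj[OF finite_words] by blast
  then show ?thesis by blast
qed

end

section \<open>The free group and its quotient by the trivially acting words\<close>

context involutive_alphabet
begin

definition reduced_words :: "'a list set" where
  "reduced_words = {w \<in> lists A. reduced ainv w}"

lemma reduced_Nil: "reduced ainv []"
  by (simp add: reduced_def)

lemma reduced_Cons: "reduced ainv (a # w) \<longleftrightarrow> (w = [] \<or> hd w \<noteq> ainv a) \<and> reduced ainv w"
  by (cases w) (auto simp: reduced_def)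

lemma cancel_cons_closed:
  "a \<in> A \<Longrightarrow> r \<in> reduced_words \<Longrightarrow> cancel_cons ainv a r \<in> reduced_words"
  by (cases r) (auto simp: reduced_words_def reduced_Cons reduced_Nil)

lemma cancel_cons_ainv:
  assumes "a \<in> A" "r \<in> reduced_words"
  shows "cancel_cons ainv a (cancel_cons ainv (ainv a) r) = r"
proof (cases r)
  case (Cons b w)
  then show ?thesis
    using assms by (cases w) (auto simp: reduced_words_def reduced_Cons ainv_ainv)
qed (use assms in \<open>simp add: ainv_ainv\<close>)

lemma foldr_cancel_cons_closed:
  "u \<in> lists A \<Longrightarrow> r \<in> reduced_words \<Longrightarrow> foldr (cancel_cons ainv) u r \<in> reduced_words"
  by (induction u) (auto intro: cancel_cons_closed)

lemma Nil_reduced: "[] \<in> reduced_words"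
  by (simp add: reduced_words_def reduced_def)

lemma free_reduce_closed: "u \<in> lists A \<Longrightarrow> free_reduce ainv u \<in> reduced_words"
  by (simp add: free_reduce_def foldr_cancel_cons_closed Nil_reduced)

lemma free_reduce_reduced: "r \<in> reduced_words \<Longrightarrow> free_reduce ainv r = r"
proof (induction r)
  case (Cons a r)
  then have "free_reduce ainv r = r" "r = [] \<or> hd r \<noteq> ainv a"
    by (auto simp: reduced_words_def reduced_Cons)
  then show ?case by (cases r) (auto simp: free_reduce_def)
qed (simp add: free_reduce_def)

lemma reduced_words_lists: "r \<in> reduced_words \<Longrightarrow> r \<in> lists A"
  by (simp add: reduced_words_def)

lemma foldr_cancel_cons_cancel_cons:
  assumes "a \<in> A" "u \<in> lists A" "r \<in> reduced_words"
  shows "foldr (cancel_cons ainv) (cancel_cons ainv a u) r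
    = cancel_cons ainv a (foldr (cancel_cons ainv) u r)"
proof (cases u)
  case (Cons b w)
  then show ?thesis
    using assms cancel_cons_ainv[OF assms(1) foldr_cancel_cons_closed[of w r]] by auto
qed simp

text \<open>
Prefixing letters with cancellation is an action of the free group on reduced words, so a word and
its reduced form act in the same way. Associativity of the free group product is a consequence.
\<close>

lemma foldr_cancel_cons_free_reduce:
  "u \<in> lists A \<Longrightarrow> r \<in> reduced_words \<Longrightarrow>
    foldr (cancel_cons ainv) (free_reduce ainv u) r = foldr (cancel_cons ainv) u r"
proof (induction u)
  case (Cons a u)
  then show ?case
    using foldr_cancel_cons_cancel_cons[of a "free_reduce ainv u" r]
      reduced_words_lists[OF free_reduce_closed[of u]]
    by (simp add: free_reduce_def)
qed (simp add: free_reduce_def)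

lemma free_reduce_append:
  "free_reduce ainv (u @ w) = foldr (cancel_cons ainv) u (free_reduce ainv w)"
  by (simp add: free_reduce_def)

lemma free_reduce_append_left:
  "u \<in> lists A \<Longrightarrow> w \<in> lists A \<Longrightarrow>
    free_reduce ainv (free_reduce ainv u @ w) = free_reduce ainv (u @ w)"
  by (simp add: free_reduce_append foldr_cancel_cons_free_reduce free_reduce_closed)

lemma free_reduce_append_right:
  "w \<in> lists A \<Longrightarrow> free_reduce ainv (u @ free_reduce ainv w) = free_reduce ainv (u @ w)"
  by (simp add: free_reduce_append free_reduce_reduced free_reduce_closed)

lemma foldr_cancel_cons_inv_word:
  "u \<in> lists A \<Longrightarrow> r \<in> reduced_words \<Longrightarrow>
    foldr (cancel_cons ainv) (inv_word ainv u) (foldr (cancel_cons ainv) u r) = r"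
proof (induction u arbitrary: r)
  case (Cons a u)
  have "cancel_cons ainv (ainv a) (cancel_cons ainv a (foldr (cancel_cons ainv) u r))
      = foldr (cancel_cons ainv) u r"
    using cancel_cons_ainv[of "ainv a" "foldr (cancel_cons ainv) u r"] Cons.prems
    by (simp add: ainv_ainv ainv_closed foldr_cancel_cons_closed)
  then show ?case using Cons by simp
qed simp

lemma free_reduce_inv_word: "u \<in> lists A \<Longrightarrow> free_reduce ainv (inv_word ainv u @ u) = []"
  using foldr_cancel_cons_inv_word[of u "[]"] by (simp add: free_reduce_def Nil_reduced)

lemma carrier_free_group: "carrier (free_group A ainv) = reduced_words"
  by (simp add: free_group_def reduced_words_def)

lemma mult_free_group: "u \<otimes>\<^bsub>free_group A ainv\<^esub> w = free_reduce ainv (u @ w)"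
  by (simp add: free_group_def)

lemma one_free_group: "\<one>\<^bsub>free_group A ainv\<^esub> = []"
  by (simp add: free_group_def)

lemma group_free_group: "group (free_group A ainv)"
proof (rule groupI; unfold carrier_free_group mult_free_group one_free_group)
  fix u assume u: "u \<in> reduced_words"
  then have uA: "u \<in> lists A" by (rule reduced_words_lists)
  show "\<exists>w \<in> reduced_words. free_reduce ainv (w @ u) = []"
    using uA free_reduce_append_left[of "inv_word ainv u" u]
    by (intro bexI[of _ "free_reduce ainv (inv_word ainv u)"])
      (simp_all add: free_reduce_closed free_reduce_inv_word del: in_lists_conv_set)
  show "free_reduce ainv ([] @ u) = u" using u by (simp add: free_reduce_reduced)
  fix w assume "w \<in> reduced_words"
  then have wA: "w \<in> lists A" by (rule reduced_words_lists)
  show "free_reduce ainv (u @ w) \<in> reduced_words" using uA wA by (simp add: free_reduce_closed)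
  fix x assume "x \<in> reduced_words"
  then have xA: "x \<in> lists A" by (rule reduced_words_lists)
  show "free_reduce ainv (free_reduce ainv (u @ w) @ x)
      = free_reduce ainv (u @ free_reduce ainv (w @ x))"
    using free_reduce_append_left[of "u @ w" x] free_reduce_append_right[of "w @ x" u] uA wA xA
    by simp
qed (rule Nil_reduced)

lemma inv_free_group:
  assumes "u \<in> reduced_words"
  shows "inv\<^bsub>free_group A ainv\<^esub> u = free_reduce ainv (inv_word ainv u)"
proof (rule group.inv_equality[OF group_free_group]; unfold carrier_free_group mult_free_group one_free_group)
  have u: "u \<in> lists A" using assms by (rule reduced_words_lists)
  then show "free_reduce ainv (free_reduce ainv (inv_word ainv u) @ u) = []"
    using free_reduce_append_left[of "inv_word ainv u" u]
    by (simp add: free_reduce_inv_word del: in_lists_conv_set)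
  show "free_reduce ainv (inv_word ainv u) \<in> reduced_words"
    using u by (simp add: free_reduce_closed del: in_lists_conv_set)
qed (rule assms)

end

lemma (in word_action) act_cancel_cons:
  "\<lbrakk>v \<in> V; a \<in> A\<rbrakk> \<Longrightarrow> act v (cancel_cons ainv a r) = act (step v a) r"
  by (cases r) (auto simp: step_step_ainv)

lemma (in word_action) act_free_reduce:
  "\<lbrakk>v \<in> V; w \<in> lists A\<rbrakk> \<Longrightarrow> act v (free_reduce ainv w) = act v w"
proof (induction w arbitrary: v)
  case (Cons a w)
  then show ?case
    using act_cancel_cons[of v a "free_reduce ainv w"] by (simp add: free_reduce_def step_closed)
qed (simp add: free_reduce_def)

locale action_family = involutive_alphabet A ainv
  for A :: "'a set" and ainv :: "'a \<Rightarrow> 'a" +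
  fixes I :: "'i set" and V :: "'i \<Rightarrow> 'v set" and step :: "'i \<Rightarrow> 'v \<Rightarrow> 'a \<Rightarrow> 'v"
  assumes member_action: "i \<in> I \<Longrightarrow> word_action A ainv (V i) (step i)"
begin

definition same_action :: "'a list \<Rightarrow> 'a list \<Rightarrow> bool" where
  "same_action u w \<longleftrightarrow> (\<forall>i \<in> I. \<forall>v \<in> V i. foldl (step i) v u = foldl (step i) v w)"

lemma same_action_refl: "same_action u u"
  by (simp add: same_action_def)

lemma same_action_sym: "same_action u w \<Longrightarrow> same_action w u"
  by (simp add: same_action_def)

lemma same_action_trans: "same_action u w \<Longrightarrow> same_action w x \<Longrightarrow> same_action u x"
  by (simp add: same_action_def)

lemma same_action_append:
  assumes "same_action u u'" "same_action w w'" "u \<in> lists A"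
  shows "same_action (u @ w) (u' @ w')"
  unfolding same_action_def
proof (intro ballI)
  fix i v assume iv: "i \<in> I" "v \<in> V i"
  interpret word_action A ainv "V i" "step i" using member_action[OF iv(1)] .
  have "foldl (step i) v u \<in> V i" using iv(2) assms(3) by (rule act_closed)
  then show "foldl (step i) v (u @ w) = foldl (step i) v (u' @ w')"
    using assms(1,2) iv by (simp add: same_action_def)
qed

lemma same_action_free_reduce: "w \<in> lists A \<Longrightarrow> same_action (free_reduce ainv w) w"
  unfolding same_action_def using word_action.act_free_reduce[OF member_action] by blast

lemma same_action_inv_word: "w \<in> lists A \<Longrightarrow> same_action (w @ inv_word ainv w) []"
  unfolding same_action_def using word_action.act_inv[OF member_action] by fastforce

definition trivial_words :: "'a list set" where
  "trivial_words = {r \<in> reduced_words. same_action r []}"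

lemma trivial_words_normal: "trivial_words \<lhd> free_group A ainv"
proof -
  interpret F: group "free_group A ainv" by (rule group_free_group)
  have closed: "free_reduce ainv (r @ s) \<in> trivial_words"
    if "r \<in> trivial_words" "s \<in> trivial_words" for r s
  proof -
    have rs: "r \<in> lists A" "s \<in> lists A" "same_action r []" "same_action s []"
      using that by (auto simp: trivial_words_def reduced_words_def)
    have "same_action (r @ s) ([] @ [])"
      by (rule same_action_append[OF rs(3,4,1)])
    moreover have "same_action (free_reduce ainv (r @ s)) (r @ s)"
      using rs(1,2) by (intro same_action_free_reduce) simp
    ultimately have "same_action (free_reduce ainv (r @ s)) []"
      using same_action_trans by simp
    then show ?thesis using rs by (simp add: trivial_words_def free_reduce_closed)
  qed
  have conj_closed: "free_reduce ainv (free_reduce ainv (x @ r) @ free_reduce ainv (inv_word ainv x))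
      \<in> trivial_words" if "x \<in> reduced_words" "r \<in> trivial_words" for x r
  proof -
    have x: "x \<in> lists A" "inv_word ainv x \<in> lists A" using that(1) by (auto simp: reduced_words_def)
    have r: "r \<in> lists A" "same_action r []"
      using that(2) by (auto simp: trivial_words_def reduced_words_def)
    have eq: "free_reduce ainv (free_reduce ainv (x @ r) @ free_reduce ainv (inv_word ainv x))
        = free_reduce ainv ((x @ r) @ inv_word ainv x)"
      using free_reduce_append_left[of "x @ r" "free_reduce ainv (inv_word ainv x)"]
        free_reduce_append_right[OF x(2), of "x @ r"] x r
        reduced_words_lists[OF free_reduce_closed[OF x(2)]] by (metis append_in_lists_conv)
    have "same_action (x @ r) (x @ [])"
      by (rule same_action_append[OF same_action_refl r(2) x(1)])
    then have "same_action ((x @ r) @ inv_word ainv x) ((x @ []) @ inv_word ainv x)"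
      using x r by (intro same_action_append same_action_refl) auto
    then have "same_action ((x @ r) @ inv_word ainv x) []"
      using same_action_trans[OF _ same_action_inv_word[OF x(1)]] by simp
    moreover have "(x @ r) @ inv_word ainv x \<in> lists A" using x r by simp
    ultimately show ?thesis unfolding eq
      using same_action_trans[OF same_action_free_reduce] free_reduce_closed
      by (simp add: trivial_words_def)
  qed
  have inv_closed: "free_reduce ainv (inv_word ainv r) \<in> trivial_words" if "r \<in> trivial_words" for r
  proof -
    have r: "r \<in> lists A" "inv_word ainv r \<in> lists A" "same_action r []"
      using that by (auto simp: trivial_words_def reduced_words_def)
    have "same_action (inv_word ainv r) (r @ inv_word ainv r)"
      using same_action_sym[OF same_action_append[OF r(3) same_action_refl r(1)]] by simp
    then have "same_action (free_reduce ainv (inv_word ainv r)) []"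
      using same_action_trans same_action_inv_word[OF r(1)] same_action_free_reduce[OF r(2)] by blast
    then show ?thesis using free_reduce_closed[OF r(2)] by (simp add: trivial_words_def)
  qed
  have "subgroup trivial_words (free_group A ainv)"
  proof
    show "trivial_words \<subseteq> carrier (free_group A ainv)"
      by (auto simp: trivial_words_def carrier_free_group)
    show "\<one>\<^bsub>free_group A ainv\<^esub> \<in> trivial_words"
      by (simp add: trivial_words_def one_free_group Nil_reduced same_action_refl)
    show "x \<otimes>\<^bsub>free_group A ainv\<^esub> y \<in> trivial_words"
      if "x \<in> trivial_words" "y \<in> trivial_words" for x y
      using closed[OF that] by (simp add: mult_free_group)
    show "inv\<^bsub>free_group A ainv\<^esub> x \<in> trivial_words" if "x \<in> trivial_words" for x
      using inv_closed[OF that] that inv_free_group by (simp add: trivial_words_def)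
  qed
  then show ?thesis
    unfolding F.normal_inv_iff using conj_closed
    by (simp add: carrier_free_group mult_free_group inv_free_group)
qed

abbreviation quotient :: "'a list set monoid" where
  "quotient \<equiv> free_group A ainv Mod trivial_words"

definition word_class :: "'a list \<Rightarrow> 'a list set" where
  "word_class w = trivial_words #>\<^bsub>free_group A ainv\<^esub> free_reduce ainv w"

lemma carrier_quotient: "carrier quotient = word_class ` lists A"
proof -
  have "carrier quotient = (\<lambda>r. trivial_words #>\<^bsub>free_group A ainv\<^esub> r) ` reduced_words"
    by (auto simp: FactGroup_def RCOSETS_def carrier_free_group)
  also have "\<dots> = (\<lambda>r. trivial_words #>\<^bsub>free_group A ainv\<^esub> r) ` free_reduce ainv ` lists A"
    using free_reduce_closed free_reduce_reduced reduced_words_lists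
    by (intro arg_cong[where f = "image _"]) force
  finally show ?thesis by (simp add: word_class_def image_image)
qed

lemma word_class_mult:
  assumes "u \<in> lists A" "w \<in> lists A"
  shows "word_class u \<otimes>\<^bsub>quotient\<^esub> word_class w = word_class (u @ w)"
proof -
  have "free_reduce ainv (free_reduce ainv u @ free_reduce ainv w) = free_reduce ainv (u @ w)"
    using free_reduce_append_left[OF assms(1)] free_reduce_append_right[OF assms(2)]
      reduced_words_lists[OF free_reduce_closed[OF assms(2)]] assms
    by (simp del: in_lists_conv_set)
  then show ?thesis
    using normal.rcos_sum[OF trivial_words_normal] free_reduce_closed assms
    by (simp add: word_class_def FactGroup_def carrier_free_group mult_free_group)
qed

lemma word_class_Nil: "word_class [] = \<one>\<^bsub>quotient\<^esub>"
proof -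
  interpret N: normal trivial_words "free_group A ainv" by (rule trivial_words_normal)
  show ?thesis
    using N.coset_mult_one[OF N.subset] by (simp add: word_class_def free_reduce_def one_free_group FactGroup_def)
qed

lemma group_quotient: "group quotient"
  by (rule normal.factorgroup_is_group[OF trivial_words_normal])

text \<open>
Words with the same action differ by the trivially acting word \<open>u @ inv_word ainv w\<close>; conversely,
neither reduction nor multiplication by a trivially acting word changes the action.
\<close>

lemma word_class_eq_iff:
  assumes "u \<in> lists A" "w \<in> lists A"
  shows "word_class u = word_class w \<longleftrightarrow> same_action u w"
proof
  interpret N: normal trivial_words "free_group A ainv" by (rule trivial_words_normal)
  let ?u = "free_reduce ainv u" and ?w = "free_reduce ainv w"
  have uw: "?u \<in> reduced_words" "?w \<in> reduced_words" using assms by (auto intro: free_reduce_closed)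
  {
    assume "word_class u = word_class w"
    then have "?u \<in> trivial_words #>\<^bsub>free_group A ainv\<^esub> ?w"
      using N.rcos_self[OF _ N.is_subgroup, of ?u] uw by (simp add: word_class_def carrier_free_group)
    then obtain r where r: "r \<in> trivial_words" "?u = free_reduce ainv (r @ ?w)"
      by (auto simp: r_coset_def mult_free_group)
    then have rA: "r \<in> lists A" "same_action r []"
      by (auto simp: trivial_words_def reduced_words_def)
    have "same_action (r @ ?w) ([] @ w)"
      using same_action_append[OF rA(2) same_action_free_reduce[OF assms(2)] rA(1)] .
    moreover have "same_action ?u (r @ ?w)"
      unfolding r(2) using rA(1) reduced_words_lists[OF uw(2)] by (intro same_action_free_reduce) simp
    ultimately show "same_action u w"
      using same_action_sym[OF same_action_free_reduce[OF assms(1)]] same_action_trans by (metis append_Nil)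
  next
    assume same: "same_action u w"
    have w': "inv_word ainv w \<in> lists A" using assms(2) by (rule inv_word_closed)
    let ?r = "free_reduce ainv (u @ inv_word ainv w)"
    have "same_action (u @ inv_word ainv w) (w @ inv_word ainv w)"
      by (rule same_action_append[OF same same_action_refl assms(1)])
    moreover have "same_action ?r (u @ inv_word ainv w)"
      using assms(1) w' by (intro same_action_free_reduce) simp
    ultimately have "same_action ?r []"
      using same_action_inv_word[OF assms(2)] same_action_trans by blast
    then have r: "?r \<in> trivial_words" using assms(1) w' by (simp add: trivial_words_def free_reduce_closed)
    have "free_reduce ainv (?r @ ?w) = free_reduce ainv (u @ (inv_word ainv w @ w))"
      using free_reduce_append_left[of "u @ inv_word ainv w" ?w]
        free_reduce_append_right[OF assms(2), of "u @ inv_word ainv w"]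
        reduced_words_lists[OF uw(2)] assms(1) w' by simp
    also have "\<dots> = ?u"
      using free_reduce_append[of u "inv_word ainv w @ w"] free_reduce_inv_word[OF assms(2)]
      by (simp add: free_reduce_def)
    finally have "?u \<in> trivial_words #>\<^bsub>free_group A ainv\<^esub> ?w"
      unfolding r_coset_def mult_free_group using r by blast
    then have "trivial_words #>\<^bsub>free_group A ainv\<^esub> ?w = trivial_words #>\<^bsub>free_group A ainv\<^esub> ?u"
      using uw by (intro N.repr_independence N.is_subgroup) (auto simp: carrier_free_group)
    then show "word_class u = word_class w" by (simp add: word_class_def)
  }
qed

lemma word_class_inv:
  assumes "w \<in> lists A"
  shows "inv\<^bsub>quotient\<^esub> word_class w = word_class (inv_word ainv w)"
proof (rule group.inv_equality[OF group_quotient])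
  have w': "inv_word ainv w \<in> lists A" using assms by (rule inv_word_closed)
  have "same_action (inv_word ainv w @ w) []"
    using same_action_inv_word[OF w'] assms by (simp del: in_lists_conv_set)
  then show "word_class (inv_word ainv w) \<otimes>\<^bsub>quotient\<^esub> word_class w = \<one>\<^bsub>quotient\<^esub>"
    using word_class_eq_iff[of "inv_word ainv w @ w" "[]"] word_class_mult[OF w' assms] assms w'
    by (simp add: word_class_Nil)
  show "word_class w \<in> carrier quotient" "word_class (inv_word ainv w) \<in> carrier quotient"
    using assms w' by (auto simp only: carrier_quotient)
qed

lemma word_class_pow:
  assumes "w \<in> lists A"
  shows "word_class w [^]\<^bsub>quotient\<^esub> (n::nat) = word_class (concat (replicate n w))"
proof (induction n)
  case 0
  show ?case by (simp add: word_class_Nil)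
next
  case (Suc n)
  have "concat (replicate n w) \<in> lists A" using assms by auto
  moreover have "concat (replicate (Suc n) w) = concat (replicate n w) @ w"
    by (induction n) auto
  ultimately show ?case using Suc assms word_class_mult by simp
qed

lemma generate_word_class:
  assumes "finite S" "S \<subseteq> carrier quotient"
  obtains W where "finite W" "W \<subseteq> lists A" "\<And>w. w \<in> W \<Longrightarrow> inv_word ainv w \<in> W"
    and "generate quotient S = (\<lambda>ws. word_class (concat ws)) ` lists W"
proof -
  interpret Q: group quotient by (rule group_quotient)
  have "\<forall>X \<in> S. \<exists>w \<in> lists A. X = word_class w" using assms(2) by (auto simp only: carrier_quotient)
  then obtain rep where rep: "\<And>X. X \<in> S \<Longrightarrow> rep X \<in> lists A" "\<And>X. X \<in> S \<Longrightarrow> word_class (rep X) = X"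
    by metis
  define W where "W = rep ` S \<union> inv_word ainv ` rep ` S"
  have WA: "W \<subseteq> lists A"
    using rep(1) inv_word_closed unfolding W_def by blast
  have W_inv: "inv_word ainv w \<in> W" if "w \<in> W" for w
    using that rep(1) by (auto simp: W_def simp del: in_lists_conv_set)
  have concat_A: "concat ws \<in> lists A" if "ws \<in> lists W" for ws using that WA by force
  have W_gen: "word_class w \<in> generate quotient S" if "w \<in> W" for w
    using that rep unfolding W_def
    by (auto simp: word_class_inv[symmetric] simp del: in_lists_conv_set intro: generate.incl generate.inv)
  have sup: "word_class (concat ws) \<in> generate quotient S" if "ws \<in> lists W" for ws
    using that
  proof induction
    case Nil
    show ?case using generate.one[of quotient S] by (simp add: word_class_Nil)
  next
    case (Cons w ws)
    have "w \<in> lists A" "concat ws \<in> lists A" using Cons.hyps WA concat_A by auto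
    then show ?case
      using generate.eng[OF W_gen[OF Cons.hyps(1)] Cons.IH] word_class_mult[of w "concat ws"] by simp
  qed
  have sub: "X \<in> (\<lambda>ws. word_class (concat ws)) ` lists W" if "X \<in> generate quotient S" for X
    using that
  proof induction
    case one
    show ?case by (rule image_eqI[of _ _ "[]"]) (simp_all add: word_class_Nil)
  next
    case (incl X)
    then show ?case by (intro image_eqI[of _ _ "[rep X]"]) (auto simp: rep W_def)
  next
    case (inv X)
    then show ?case
      using word_class_inv[of "rep X"] rep
      by (intro image_eqI[of _ _ "[inv_word ainv (rep X)]"]) (auto simp: W_def simp del: in_lists_conv_set)
  next
    case (eng X Y)
    then obtain us ws where "us \<in> lists W" "X = word_class (concat us)"
        "ws \<in> lists W" "Y = word_class (concat ws)" by blast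
    then show ?case
      using word_class_mult concat_A by (intro image_eqI[of _ _ "us @ ws"]) auto
  qed
  have "generate quotient S = (\<lambda>ws. word_class (concat ws)) ` lists W"
    by (intro equalityI subsetI image_subsetI sub sup)
  moreover have "finite W" using assms(1) by (simp add: W_def)
  ultimately show ?thesis using that[OF _ WA W_inv] by simp
qed

text \<open>
The generators of \<open>H\<close> are represented by words whose products are torsion, hence have bounded orbits
in each of the finitely many actions. On the disjoint union of the vertex sets the products therefore
act in finitely many ways, and the action determines the element.
\<close>

lemma finitely_generated_torsion_finite:
  fixes P :: "'i \<Rightarrow> ('n, 'a) production set"
  assumes "finite I"
    and cf: "\<And>i. i \<in> I \<Longrightarrow> context_free_action A ainv (V i) (step i) (x0 i) (P i) (S i)"
    and fg: "finitely_generated_in quotient H" and torsion: "torsion_in quotient H"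
  shows "finite H"
proof -
  obtain W where W: "finite W" "W \<subseteq> lists A" "\<And>w. w \<in> W \<Longrightarrow> inv_word ainv w \<in> W"
      "H = (\<lambda>ws. word_class (concat ws)) ` lists W"
    using fg generate_word_class unfolding finitely_generated_in_def by metis
  have concat_A: "concat ws \<in> lists A" if "ws \<in> lists W" for ws using that W(2) by force
  have tors: "\<exists>t>0. \<forall>v \<in> V i. foldl (step i) v (concat (replicate t (concat ws))) = v"
    if "i \<in> I" "ws \<in> lists W" for i ws
  proof -
    have "word_class (concat ws) \<in> H" using W(4) that(2) by blast
    with torsion obtain t :: nat where t: "t > 0"
        "word_class (concat ws) [^]\<^bsub>quotient\<^esub> t = \<one>\<^bsub>quotient\<^esub>"
      unfolding torsion_in_def by blast
    have "concat (replicate t (concat ws)) \<in> lists A" using concat_A[OF that(2)] by (auto split: if_splits)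
    moreover have "word_class (concat (replicate t (concat ws))) = word_class []"
      using t(2) word_class_pow[OF concat_A[OF that(2)], of t] word_class_Nil by simp
    ultimately have "same_action (concat (replicate t (concat ws))) []"
      using word_class_eq_iff by blast
    then show ?thesis using t(1) that(1) unfolding same_action_def by force
  qed
  have "\<exists>B. \<forall>v \<in> V i. finite ((\<lambda>ws. foldl (step i) v (concat ws)) ` lists W)
      \<and> card ((\<lambda>ws. foldl (step i) v (concat ws)) ` lists W) \<le> B" if "i \<in> I" for i
    using context_free_action.torsion_orbits_bounded[OF cf[OF that] W(1-3) tors[OF that]] by blast
  then obtain B where B: "\<And>i v. i \<in> I \<Longrightarrow> v \<in> V i \<Longrightarrow>
      finite ((\<lambda>ws. foldl (step i) v (concat ws)) ` lists W)
      \<and> card ((\<lambda>ws. foldl (step i) v (concat ws)) ` lists W) \<le> B i"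
    by metis
  define g where "g = (\<lambda>(i, v) w. (i, foldl (step i) v w))"
  have g: "foldl g (i, v) ws = (i, foldl (step i) v (concat ws))" for i v ws
    by (induction ws arbitrary: v) (auto simp: g_def)
  have "finite (foldl g x ` lists W) \<and> card (foldl g x ` lists W) \<le> sum B I"
    if "x \<in> Sigma I V" for x
  proof -
    from that obtain i v where iv: "x = (i, v)" "i \<in> I" "v \<in> V i" by auto
    let ?O = "(\<lambda>ws. foldl (step i) v (concat ws)) ` lists W"
    have "foldl g x ` lists W = Pair i ` ?O" by (simp add: iv(1) g image_image)
    moreover have "card ?O \<le> B i" "finite ?O" using B[OF iv(2,3)] by simp_all
    moreover have "B i \<le> sum B I" using iv(2) assms(1) by (simp add: member_le_sum)
    ultimately show ?thesis using card_image_le[of ?O "Pair i"] by simp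
  qed
  then have "finite ((\<lambda>ws. restrict (\<lambda>x. foldl g x ws) (Sigma I V)) ` lists W)"
    by (rule finitely_many_actions_if_bounded_orbits[OF W(1)])
  then have "finite ((\<lambda>ws. word_class (concat ws)) ` lists W)"
  proof (rule finite_image_if_factors)
    fix us ws assume uw: "us \<in> lists W" "ws \<in> lists W"
      and eq: "restrict (\<lambda>x. foldl g x us) (Sigma I V) = restrict (\<lambda>x. foldl g x ws) (Sigma I V)"
    have "foldl g (i, v) us = foldl g (i, v) ws" if "i \<in> I" "v \<in> V i" for i v
      using fun_cong[OF eq, of "(i, v)"] that by simp
    then have "same_action (concat us) (concat ws)" by (simp add: same_action_def g)
    then show "word_class (concat us) = word_class (concat ws)"
      using word_class_eq_iff concat_A uw by blast
  qed
  then show ?thesis using W(4) by simp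
qed

end

section \<open>Transition groups of complete graphs\<close>

text \<open>
In a complete deterministic graph the described edge exists and is unique.
\<close>

definition graph_step :: "('v, 'e, 'a) labeled_graph \<Rightarrow> 'v \<Rightarrow> 'a \<Rightarrow> 'v" where
  "graph_step \<Gamma> v a = head (graph_of \<Gamma>)
     (THE e. e \<in> arcs (graph_of \<Gamma>) \<and> tail (graph_of \<Gamma>) e = v \<and> edge_label \<Gamma> e = a)"

locale complete_A_graph = A_graph A ainv \<Gamma>
  for A :: "'a set" and ainv :: "'a \<Rightarrow> 'a" and \<Gamma> :: "('v, 'e, 'a) labeled_graph" +
  assumes complete: "complete_graph A \<Gamma>"
begin

lemma graph_step_arc:
  "e \<in> arcs (graph_of \<Gamma>) \<Longrightarrow> graph_step \<Gamma> (tail (graph_of \<Gamma>) e) (edge_label \<Gamma> e) = head (graph_of \<Gamma>) e"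
  unfolding graph_step_def
  by (rule arg_cong[of _ _ "head (graph_of \<Gamma>)"], rule the_equality) (auto intro: deterministic)

lemma arc_exists:
  assumes "v \<in> verts (graph_of \<Gamma>)" "a \<in> A"
  obtains e where "e \<in> arcs (graph_of \<Gamma>)" "tail (graph_of \<Gamma>) e = v" "edge_label \<Gamma> e = a"
    "head (graph_of \<Gamma>) e = graph_step \<Gamma> v a"
  using complete assms graph_step_arc unfolding complete_graph_def by metis

sublocale word_action A ainv "verts (graph_of \<Gamma>)" "graph_step \<Gamma>"
proof
  fix v a assume va: "v \<in> verts (graph_of \<Gamma>)" "a \<in> A"
  obtain e where e: "e \<in> arcs (graph_of \<Gamma>)" "tail (graph_of \<Gamma>) e = v" "edge_label \<Gamma> e = a"
      "head (graph_of \<Gamma>) e = graph_step \<Gamma> v a"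
    using arc_exists[OF va] .
  show "graph_step \<Gamma> v a \<in> verts (graph_of \<Gamma>)" using e head_in_verts by metis
  show "graph_step \<Gamma> (graph_step \<Gamma> v a) (ainv a) = v"
    using graph_step_arc[of "edge_inv \<Gamma> e"] e label_edge_inv[OF e(1)] by simp
qed

lemma awalk_act:
  "awalk v p v' \<Longrightarrow> map (edge_label \<Gamma>) p \<in> lists A \<and> act v (map (edge_label \<Gamma>) p) = v'"
  by (induction p arbitrary: v)
    (auto simp: awalk_simps graph_step_arc label_in_alphabet)

lemma act_awalk:
  "\<lbrakk>v \<in> verts (graph_of \<Gamma>); w \<in> lists A\<rbrakk> \<Longrightarrow> \<exists>p. awalk v p (act v w) \<and> map (edge_label \<Gamma>) p = w"
proof (induction w arbitrary: v)
  case Nil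
  then show ?case by (simp add: awalk_Nil_iff)
next
  case (Cons a w)
  then have va: "v \<in> verts (graph_of \<Gamma>)" "a \<in> A" by auto
  obtain e where e: "e \<in> arcs (graph_of \<Gamma>)" "tail (graph_of \<Gamma>) e = v" "edge_label \<Gamma> e = a"
      "head (graph_of \<Gamma>) e = graph_step \<Gamma> v a"
    using arc_exists[OF va] .
  obtain p where "awalk (graph_step \<Gamma> v a) p (act (graph_step \<Gamma> v a) w)" "map (edge_label \<Gamma>) p = w"
    using Cons.IH[OF step_closed[OF va]] Cons.prems by auto
  then show ?case using e by (intro exI[of _ "e # p"]) (simp add: awalk_Cons_iff)
qed

lemma circuit_language_act:
  assumes "x \<in> verts (graph_of \<Gamma>)"
  shows "circuit_language \<Gamma> x = {w \<in> lists A. act x w = x}"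
proof (intro equalityI subsetI)
  show "w \<in> {w \<in> lists A. act x w = x}" if "w \<in> circuit_language \<Gamma> x" for w
    using that awalk_act unfolding circuit_language_def by blast
  show "w \<in> circuit_language \<Gamma> x" if "w \<in> {w \<in> lists A. act x w = x}" for w
    using that act_awalk[OF assms, of w] unfolding circuit_language_def by auto
qed

lemma act_transitive:
  assumes "x \<in> verts (graph_of \<Gamma>)" "v \<in> verts (graph_of \<Gamma>)"
  shows "\<exists>w \<in> lists A. act x w = v"
proof -
  have "symmetric (graph_of \<Gamma>)"
    unfolding symmetric_conv
  proof
    fix e assume "e \<in> arcs (graph_of \<Gamma>)"
    then show "\<exists>e' \<in> arcs (graph_of \<Gamma>). tail (graph_of \<Gamma>) e = head (graph_of \<Gamma>) e'
        \<and> head (graph_of \<Gamma>) e = tail (graph_of \<Gamma>) e'"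
      by (intro bexI[of _ "edge_inv \<Gamma> e"]) simp_all
  qed
  then have "strongly_connected (graph_of \<Gamma>)"
    using graph_connected by (rule symmetric_connected_imp_strongly_connected)
  then have "x \<rightarrow>\<^sup>*\<^bsub>graph_of \<Gamma>\<^esub> v" using assms by auto
  then obtain p where "awalk x p v" unfolding reachable_awalk by blast
  then show ?thesis using awalk_act by blast
qed

lemma context_free_action:
  assumes "context_free_graph \<Gamma>"
  obtains x and P :: "(nat, 'a) production set" and S
  where "context_free_action A ainv (verts (graph_of \<Gamma>)) (graph_step \<Gamma>) x P S"
proof -
  obtain x and P :: "(nat, 'a) production set" and S where *: "x \<in> verts (graph_of \<Gamma>)" "finite P"
      "circuit_language \<Gamma> x = grammar_language P S"
    using assms unfolding context_free_graph_def context_free_language_def by blast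
  have "context_free_action A ainv (verts (graph_of \<Gamma>)) (graph_step \<Gamma>) x P S"
  proof
    show "generates P [Nonterm S] w \<longleftrightarrow> w \<in> lists A \<and> act x w = x" for w
      using *(3) circuit_language_act[OF *(1)] by (auto simp: grammar_language_generates)
  qed (use * act_transitive in auto)
  then show ?thesis using that by blast
qed

end

theorem corollary5p8:
  fixes A :: "'a set" and ainv :: "'a \<Rightarrow> 'a"
    and k :: nat and \<Gamma> :: "nat \<Rightarrow> ('v, 'e, 'a) labeled_graph"
  assumes "involutive_alphabet A ainv"
    and "\<And>i. i \<in> {1..k} \<Longrightarrow> A_graph A ainv (\<Gamma> i)"
    and "\<And>i. i \<in> {1..k} \<Longrightarrow> complete_graph A (\<Gamma> i)"
    and "\<And>i. i \<in> {1..k} \<Longrightarrow> context_free_graph (\<Gamma> i)"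
    and "infinite (carrier (transition_group A ainv \<Gamma> {1..k}))"
  shows "\<not> (\<exists>H. subgroup H (transition_group A ainv \<Gamma> {1..k})
               \<and> infinite H
               \<and> finitely_generated_in (transition_group A ainv \<Gamma> {1..k}) H
               \<and> torsion_in (transition_group A ainv \<Gamma> {1..k}) H)"
proof -
  have graph: "complete_A_graph A ainv (\<Gamma> i)" if "i \<in> {1..k}" for i
    using assms(2,3)[OF that] by (simp add: complete_A_graph_def complete_A_graph_axioms_def)
  interpret action_family A ainv "{1..k}" "\<lambda>i. verts (graph_of (\<Gamma> i))" "\<lambda>i. graph_step (\<Gamma> i)"
  proof (intro action_family.intro action_family_axioms.intro assms(1))
    fix i assume "i \<in> {1..k}"
    then interpret complete_A_graph A ainv "\<Gamma> i" by (rule graph)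
    show "word_action A ainv (verts (graph_of (\<Gamma> i))) (graph_step (\<Gamma> i))"
      by unfold_locales
  qed
  have mem: "w \<in> (\<Inter>i \<in> {1..k}. \<Inter>p \<in> verts (graph_of (\<Gamma> i)). circuit_language (\<Gamma> i) p) \<longleftrightarrow> same_action w []"
    if "w \<in> lists A" for w
    unfolding same_action_def using that complete_A_graph.circuit_language_act[OF graph] by simp
  have "transition_kernel A ainv \<Gamma> {1..k} = trivial_words"
  proof
    show "transition_kernel A ainv \<Gamma> {1..k} \<subseteq> trivial_words"
    proof
      fix r assume "r \<in> transition_kernel A ainv \<Gamma> {1..k}"
      then obtain w where w: "w \<in> lists A" "same_action w []" "r = free_reduce ainv w"
        unfolding transition_kernel_def using mem by blast
      then have "same_action r []" using same_action_free_reduce same_action_trans by blast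
      then show "r \<in> trivial_words" using w free_reduce_closed unfolding trivial_words_def by blast
    qed
    show "trivial_words \<subseteq> transition_kernel A ainv \<Gamma> {1..k}"
    proof
      fix r assume "r \<in> trivial_words"
      then have r: "r \<in> lists A" "same_action r []" "r = free_reduce ainv r"
        using free_reduce_reduced[of r] reduced_words_lists unfolding trivial_words_def by (blast, blast, simp)
      then show "r \<in> transition_kernel A ainv \<Gamma> {1..k}"
        unfolding transition_kernel_def using mem[OF r(1)] by blast
    qed
  qed
  then have group: "transition_group A ainv \<Gamma> {1..k} = quotient" by (simp add: transition_group_def)
  have "\<forall>i \<in> {1..k}. \<exists>x (P :: (nat, 'a) production set) S.
      context_free_action A ainv (verts (graph_of (\<Gamma> i))) (graph_step (\<Gamma> i)) x P S"
    using complete_A_graph.context_free_action[OF graph assms(4)] by metis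
  then obtain x0 and P :: "nat \<Rightarrow> (nat, 'a) production set" and S where
    cf: "\<And>i. i \<in> {1..k} \<Longrightarrow>
      context_free_action A ainv (verts (graph_of (\<Gamma> i))) (graph_step (\<Gamma> i)) (x0 i) (P i) (S i)"
    by metis
  have "finite H" if "finitely_generated_in quotient H" "torsion_in quotient H" for H
    by (rule finitely_generated_torsion_finite[OF finite_atLeastAtMost cf that])
  then show ?thesis unfolding group by blast
qed

end
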